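(* Let $K$ be a presented field with elimination theory and let $M$ be a perfect subfield of $\tilde K$ that contains $K$. Suppose that the existential theory $\mathrm{Ex}(M)$ of $M$ in $\mathcal L(\mathrm{ring},K)$ is decidable (resp. primitively decidable). Then $\tilde K$ has a recursive (resp. primitive recursive) subfield $L$ that contains $K$ and is $K$-isomorphic to $M$.
   Context: A presented field $K$ with elimination theory (Fried–Jarden, Field Arithmetic, Def. 19.2.8) is a field explicitly constructed from $\mathbb Z$ with primitive recursive field operations and a primitive recursive algorithm factoring polynomials in $K[X]$ into irreducibles, and in which roots can be primitive recursively adjoined; then $K_s$ and $\tilde K$ are presented with elimination theory. A subfield of $\tilde K$ is recursive (resp. primitive recursive) if it is a recursive (resp. primitive recursive) subset of $\tilde K$ in this presentation. $\mathcal L(\mathrm{ring},K)$ is the language of rings with a constant symbol for each element of $K$; $\mathrm{Ex}(M)$ is the set of existential sentences of this language (sentences equivalent to $(\exists X_1)\cdots(\exists X_n)[\bigvee_i\bigwedge_j f_{ij}=0]$) true in $M$, and it is decidable (resp. primitively decidable) if an algorithm (resp. primitive recursive algorithm) decides whether a given existential sentence holds in $M$. *)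

theory Defs
  imports "HOL-Algebra.Algebraic_Closure_Type" "HOL-Library.Nat_Bijection"
begin

section \<open>Primitive recursive and recursive functions\<close>

text \<open>
  A function of arity \<open>n\<close> is modelled as a function on lists of which only the
  values on lists of length \<open>n\<close> matter. The library has no computability theory.
\<close>

inductive primrec_list :: "nat \<Rightarrow> (nat list \<Rightarrow> nat) \<Rightarrow> bool" where
  zero: "primrec_list n (\<lambda>_. 0)"
| succ: "primrec_list 1 (\<lambda>xs. Suc (hd xs))"
| proj: "i < n \<Longrightarrow> primrec_list n (\<lambda>xs. xs ! i)"
| comp: "primrec_list (length gs) f \<Longrightarrow> (\<And>g. g \<in> set gs \<Longrightarrow> primrec_list n g) \<Longrightarrow>
         primrec_list n (\<lambda>xs. f (map (\<lambda>g. g xs) gs))"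
| prec: "primrec_list n f \<Longrightarrow> primrec_list (Suc (Suc n)) g \<Longrightarrow>
         primrec_list (Suc n) (\<lambda>xs. rec_nat (f (tl xs)) (\<lambda>k r. g (k # r # tl xs)) (hd xs))"

text \<open>
  Minimization is only applied to functions that have a zero for every choice of the
  parameters, so this class consists of the total recursive functions.
\<close>

inductive recursive_list :: "nat \<Rightarrow> (nat list \<Rightarrow> nat) \<Rightarrow> bool" where
  zero: "recursive_list n (\<lambda>_. 0)"
| succ: "recursive_list 1 (\<lambda>xs. Suc (hd xs))"
| proj: "i < n \<Longrightarrow> recursive_list n (\<lambda>xs. xs ! i)"
| comp: "recursive_list (length gs) f \<Longrightarrow> (\<And>g. g \<in> set gs \<Longrightarrow> recursive_list n g) \<Longrightarrow>
         recursive_list n (\<lambda>xs. f (map (\<lambda>g. g xs) gs))"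
| prec: "recursive_list n f \<Longrightarrow> recursive_list (Suc (Suc n)) g \<Longrightarrow>
         recursive_list (Suc n) (\<lambda>xs. rec_nat (f (tl xs)) (\<lambda>k r. g (k # r # tl xs)) (hd xs))"
| mini: "recursive_list (Suc n) f \<Longrightarrow> (\<And>xs. length xs = n \<Longrightarrow> \<exists>y. f (y # xs) = 0) \<Longrightarrow>
         recursive_list n (\<lambda>xs. LEAST y. f (y # xs) = 0)"

definition primrec_fun :: "(nat \<Rightarrow> nat) \<Rightarrow> bool" where
  "primrec_fun f \<longleftrightarrow> (\<exists>F. primrec_list 1 F \<and> (\<forall>x. f x = F [x]))"

definition primrec_fun2 :: "(nat \<Rightarrow> nat \<Rightarrow> nat) \<Rightarrow> bool" where
  "primrec_fun2 f \<longleftrightarrow> (\<exists>F. primrec_list 2 F \<and> (\<forall>x y. f x y = F [x, y]))"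

definition recursive_fun :: "(nat \<Rightarrow> nat) \<Rightarrow> bool" where
  "recursive_fun f \<longleftrightarrow> (\<exists>F. recursive_list 1 F \<and> (\<forall>x. f x = F [x]))"

definition primrec_set :: "nat set \<Rightarrow> bool" where
  "primrec_set A \<longleftrightarrow> primrec_fun (\<lambda>n. of_bool (n \<in> A))"

definition recursive_set :: "nat set \<Rightarrow> bool" where
  "recursive_set A \<longleftrightarrow> recursive_fun (\<lambda>n. of_bool (n \<in> A))"


section \<open>Subfields of the algebraic closure\<close>

text \<open>
  The base field \<open>K\<close> is a type \<open>'k\<close>, its algebraic closure is the type
  \<open>'k alg_closure\<close>, and \<open>K\<close> is identified with \<open>range to_ac\<close>.
\<close>

definition is_subfield :: "'a :: field set \<Rightarrow> bool" where
  "is_subfield F \<longleftrightarrow> 0 \<in> F \<and> 1 \<in> F \<and>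
     (\<forall>x\<in>F. \<forall>y\<in>F. x + y \<in> F \<and> x * y \<in> F) \<and> (\<forall>x\<in>F. - x \<in> F \<and> inverse x \<in> F)"

definition adjoin :: "'k :: field alg_closure set \<Rightarrow> 'k alg_closure set" where
  "adjoin A = \<Inter>{F. is_subfield F \<and> range to_ac \<subseteq> F \<and> A \<subseteq> F}"

definition poly_over :: "'a :: field set \<Rightarrow> 'a poly \<Rightarrow> bool" where
  "poly_over F p \<longleftrightarrow> set (coeffs p) \<subseteq> F"

definition irreducible_over :: "'a :: field set \<Rightarrow> 'a poly \<Rightarrow> bool" where
  "irreducible_over F p \<longleftrightarrow> poly_over F p \<and> degree p > 0 \<and>
     (\<forall>q r. poly_over F q \<and> poly_over F r \<and> p = q * r \<longrightarrow> degree q = 0 \<or> degree r = 0)"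

text \<open>
  Every irreducible polynomial over \<open>F\<close> is separable, i.e. has only simple roots in the
  ambient algebraically closed field.
\<close>

definition perfect_subfield :: "'a :: alg_closed_field set \<Rightarrow> bool" where
  "perfect_subfield F \<longleftrightarrow> is_subfield F \<and> (\<forall>p. irreducible_over F p \<longrightarrow> rsquarefree p)"

definition K_isomorphic :: "'k :: field alg_closure set \<Rightarrow> 'k alg_closure set \<Rightarrow> bool" where
  "K_isomorphic M L \<longleftrightarrow> (\<exists>\<sigma>. bij_betw \<sigma> M L \<and>
     (\<forall>x\<in>M. \<forall>y\<in>M. \<sigma> (x + y) = \<sigma> x + \<sigma> y \<and> \<sigma> (x * y) = \<sigma> x * \<sigma> y) \<and>
     (\<forall>a. \<sigma> (to_ac a) = to_ac a))"


section \<open>The language of rings with constants from a field\<close>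

text \<open>
  The terms stand for polynomials over \<open>K\<close> in the indeterminates \<open>Var 0, Var 1, \<dots>\<close>.
\<close>

datatype 'k rterm =
    Const 'k | Var nat | Neg "'k rterm" | Add "'k rterm" "'k rterm" | Mul "'k rterm" "'k rterm"

primrec eval_rterm :: "(nat \<Rightarrow> 'k :: field alg_closure) \<Rightarrow> 'k rterm \<Rightarrow> 'k alg_closure" where
  "eval_rterm \<rho> (Const a) = to_ac a"
| "eval_rterm \<rho> (Var i) = \<rho> i"
| "eval_rterm \<rho> (Neg s) = - eval_rterm \<rho> s"
| "eval_rterm \<rho> (Add s t) = eval_rterm \<rho> s + eval_rterm \<rho> t"
| "eval_rterm \<rho> (Mul s t) = eval_rterm \<rho> s * eval_rterm \<rho> t"

primrec rterm_vars :: "'k rterm \<Rightarrow> nat set" where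
  "rterm_vars (Const a) = {}"
| "rterm_vars (Var i) = {i}"
| "rterm_vars (Neg s) = rterm_vars s"
| "rterm_vars (Add s t) = rterm_vars s \<union> rterm_vars t"
| "rterm_vars (Mul s t) = rterm_vars s \<union> rterm_vars t"

primrec rterm_code :: "('k \<Rightarrow> nat) \<Rightarrow> 'k rterm \<Rightarrow> nat" where
  "rterm_code \<kappa> (Const a) = prod_encode (0, \<kappa> a)"
| "rterm_code \<kappa> (Var i) = prod_encode (1, i)"
| "rterm_code \<kappa> (Neg s) = prod_encode (2, rterm_code \<kappa> s)"
| "rterm_code \<kappa> (Add s t) = prod_encode (3, prod_encode (rterm_code \<kappa> s, rterm_code \<kappa> t))"
| "rterm_code \<kappa> (Mul s t) = prod_encode (4, prod_encode (rterm_code \<kappa> s, rterm_code \<kappa> t))"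

text \<open>
  The list \<open>[[f\<^sub>1\<^sub>1, f\<^sub>1\<^sub>2, \<dots>], [f\<^sub>2\<^sub>1, \<dots>], \<dots>]\<close> stands for the existential sentence
  \<open>\<exists>X\<^sub>0 X\<^sub>1 \<dots>. \<Or>\<^sub>i \<And>\<^sub>j f\<^sub>i\<^sub>j = 0\<close>, in which all occurring variables are quantified.
\<close>

type_synonym 'k ex_sentence = "'k rterm list list"

definition holds_in :: "'k :: field alg_closure set \<Rightarrow> 'k ex_sentence \<Rightarrow> bool" where
  "holds_in M S \<longleftrightarrow> (\<exists>\<rho>. range \<rho> \<subseteq> M \<and> (\<exists>C\<in>set S. \<forall>t\<in>set C. eval_rterm \<rho> t = 0))"

definition sentence_code :: "('k \<Rightarrow> nat) \<Rightarrow> 'k ex_sentence \<Rightarrow> nat" where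
  "sentence_code \<kappa> S = list_encode (map (\<lambda>C. list_encode (map (rterm_code \<kappa>) C)) S)"

definition Ex_theory :: "'k :: field alg_closure set \<Rightarrow> 'k ex_sentence set" where
  "Ex_theory M = {S. holds_in M S}"

definition decidable_Ex :: "('k :: field \<Rightarrow> nat) \<Rightarrow> 'k alg_closure set \<Rightarrow> bool" where
  "decidable_Ex \<kappa> M \<longleftrightarrow>
     (\<exists>f. recursive_fun f \<and> (\<forall>S. f (sentence_code \<kappa> S) = of_bool (S \<in> Ex_theory M)))"

definition primitively_decidable_Ex :: "('k :: field \<Rightarrow> nat) \<Rightarrow> 'k alg_closure set \<Rightarrow> bool" where
  "primitively_decidable_Ex \<kappa> M \<longleftrightarrow>
     (\<exists>f. primrec_fun f \<and> (\<forall>S. f (sentence_code \<kappa> S) = of_bool (S \<in> Ex_theory M)))"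


section \<open>Presented fields with elimination theory\<close>

definition presented_field :: "('f :: field \<Rightarrow> nat) \<Rightarrow> bool" where
  "presented_field \<kappa> \<longleftrightarrow> inj \<kappa> \<and> primrec_set (range \<kappa>) \<and>
     (\<exists>f. primrec_fun2 f \<and> (\<forall>x y. \<kappa> (x + y) = f (\<kappa> x) (\<kappa> y))) \<and>
     (\<exists>f. primrec_fun2 f \<and> (\<forall>x y. \<kappa> (x * y) = f (\<kappa> x) (\<kappa> y))) \<and>
     (\<exists>f. primrec_fun f \<and> (\<forall>x. \<kappa> (- x) = f (\<kappa> x))) \<and>
     (\<exists>f. primrec_fun f \<and> (\<forall>x. x \<noteq> 0 \<longrightarrow> \<kappa> (inverse x) = f (\<kappa> x)))"

definition poly_code :: "('f :: zero \<Rightarrow> nat) \<Rightarrow> 'f poly \<Rightarrow> nat" where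
  "poly_code \<kappa> p = list_encode (map \<kappa> (coeffs p))"

definition has_splitting_algorithm :: "('f :: field \<Rightarrow> nat) \<Rightarrow> bool" where
  "has_splitting_algorithm \<kappa> \<longleftrightarrow>
     (\<exists>f. primrec_fun f \<and>
        (\<forall>p. p \<noteq> 0 \<longrightarrow>
           (\<exists>qs. f (poly_code \<kappa> p) = list_encode (map (poly_code \<kappa>) qs) \<and>
                 p = smult (lead_coeff p) (prod_list qs) \<and>
                 (\<forall>q\<in>set qs. lead_coeff q = 1 \<and> irreducible q))))"

text \<open>
  A finite extension \<open>K(a\<^sub>0, \<dots>, a\<^sub>n\<^sub>-\<^sub>1)\<close> is given by successive root adjunctions, i.e. by
  polynomials \<open>f\<^sub>i\<close> in one variable with coefficients in \<open>K[X\<^sub>0, \<dots>, X\<^sub>i\<^sub>-\<^sub>1]\<close> such that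
  \<open>f\<^sub>i(a\<^sub>0, \<dots>, a\<^sub>i\<^sub>-\<^sub>1, X)\<close> is the irreducible polynomial of \<open>a\<^sub>i\<close> over
  \<open>K(a\<^sub>0, \<dots>, a\<^sub>i\<^sub>-\<^sub>1)\<close>. This determines the extension and its generators up to
  \<open>K\<close>-isomorphism. The elements of the extension are the values of terms at the \<open>a\<^sub>i\<close>.
\<close>

definition spec_poly :: "(nat \<Rightarrow> 'k :: field alg_closure) \<Rightarrow> 'k rterm list \<Rightarrow> 'k alg_closure poly" where
  "spec_poly \<rho> cs = Poly (map (eval_rterm \<rho>) cs)"

definition coeffs_vars_below :: "nat \<Rightarrow> 'k rterm list \<Rightarrow> bool" where
  "coeffs_vars_below n cs \<longleftrightarrow> (\<forall>t\<in>set cs. rterm_vars t \<subseteq> {..<n})"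

definition root_tower :: "(nat \<Rightarrow> 'k :: field alg_closure) \<Rightarrow> 'k rterm list list \<Rightarrow> bool" where
  "root_tower \<rho> fs \<longleftrightarrow> (\<forall>i<length fs. coeffs_vars_below i (fs ! i) \<and>
     lead_coeff (spec_poly \<rho> (fs ! i)) = 1 \<and>
     irreducible_over (adjoin (\<rho> ` {..<i})) (spec_poly \<rho> (fs ! i)) \<and>
     poly (spec_poly \<rho> (fs ! i)) (\<rho> i) = 0)"

definition rterm_lists_code :: "('k \<Rightarrow> nat) \<Rightarrow> 'k rterm list list \<Rightarrow> nat" where
  "rterm_lists_code \<kappa> fs = list_encode (map (\<lambda>f. list_encode (map (rterm_code \<kappa>) f)) fs)"

text \<open>
  The splitting algorithm extends, primitive recursively in the root adjunctions, to all
  finite extensions.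
\<close>

definition has_effective_root_adjunction :: "('k :: field \<Rightarrow> nat) \<Rightarrow> bool" where
  "has_effective_root_adjunction \<kappa> \<longleftrightarrow>
     (\<exists>\<Phi>. primrec_fun2 \<Phi> \<and>
        (\<forall>fs g \<rho>. root_tower \<rho> fs \<and> coeffs_vars_below (length fs) g \<and> spec_poly \<rho> g \<noteq> 0 \<longrightarrow>
           (\<exists>hs. \<Phi> (rterm_lists_code \<kappa> fs) (list_encode (map (rterm_code \<kappa>) g)) =
                   rterm_lists_code \<kappa> hs \<and>
                 spec_poly \<rho> g = smult (lead_coeff (spec_poly \<rho> g))
                                       (prod_list (map (spec_poly \<rho>) hs)) \<and>
                 (\<forall>h\<in>set hs. coeffs_vars_below (length fs) h \<and>
                    lead_coeff (spec_poly \<rho> h) = 1 \<and>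
                    irreducible_over (adjoin (\<rho> ` {..<length fs})) (spec_poly \<rho> h)))))"

definition presented_with_elimination_theory :: "('k :: field \<Rightarrow> nat) \<Rightarrow> bool" where
  "presented_with_elimination_theory \<kappa> \<longleftrightarrow>
     presented_field \<kappa> \<and> has_splitting_algorithm \<kappa> \<and> has_effective_root_adjunction \<kappa>"

text \<open>
  A presentation \<open>\<nu>\<close> of the algebraic closure that extends the presentation \<open>\<kappa>\<close> of \<open>K\<close>: the
  inclusion of \<open>K\<close> is primitive recursive, and a nonzero polynomial over \<open>K\<close> that vanishes
  at \<open>x\<close> can be computed primitive recursively from \<open>x\<close>. With the splitting algorithm of
  \<open>K\<close> one obtains the irreducible polynomial of \<open>x\<close> over \<open>K\<close>, hence also that \<open>K\<close> is a
  primitive recursive subset.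
\<close>

definition presents_alg_closure :: "('k :: field \<Rightarrow> nat) \<Rightarrow> ('k alg_closure \<Rightarrow> nat) \<Rightarrow> bool" where
  "presents_alg_closure \<kappa> \<nu> \<longleftrightarrow>
     presented_with_elimination_theory \<nu> \<and>
     (\<exists>f. primrec_fun f \<and> (\<forall>a. \<nu> (to_ac a) = f (\<kappa> a))) \<and>
     (\<exists>f. primrec_fun f \<and>
        (\<forall>x. \<exists>p. p \<noteq> 0 \<and> poly (map_poly to_ac p) x = 0 \<and> f (\<nu> x) = poly_code \<kappa> p))"

definition recursive_subfield :: "('k :: field alg_closure \<Rightarrow> nat) \<Rightarrow> 'k alg_closure set \<Rightarrow> bool" where
  "recursive_subfield \<nu> L \<longleftrightarrow> is_subfield L \<and> recursive_set (\<nu> ` L)"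

definition primrec_subfield :: "('k :: field alg_closure \<Rightarrow> nat) \<Rightarrow> 'k alg_closure set \<Rightarrow> bool" where
  "primrec_subfield \<nu> L \<longleftrightarrow> is_subfield L \<and> primrec_set (\<nu> ` L)"

end

theory Submission
  imports Defs "HOL-Library.Diagonal_Subsequence"
begin

text \<open>
  Run through the elements of the algebraic closure in the order of their codes and accept an
  element \<open>x\<close> if \<open>K(A, x)\<close> embeds over \<open>K\<close> into \<open>M\<close>, where \<open>A\<close> is the finite set of elements
  accepted before. The accepted elements form a field \<open>L\<close>. As every element has only finitely
  many conjugates, the embeddings of the finite stages give a limit embedding of \<open>L\<close> into \<open>M\<close>.
  It is onto: for \<open>x\<close> in \<open>M\<close> extend the inverse to \<open>x\<close>, with value \<open>y\<close>; then \<open>L(y)\<close> still embeds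
  into \<open>M\<close>, hence \<open>y\<close> was accepted.

  Each decision is effective. The elements accepted before come with the irreducible
  polynomials of a tower of root adjunctions over \<open>K\<close>, and factoring a polynomial of \<open>x\<close> over
  this tower and evaluating the factors at \<open>x\<close> yields the next one. That the equations of the
  tower have a common zero in \<open>M\<close> is an existential sentence, and it holds if and only if the
  tower embeds into \<open>M\<close>. All steps except for the decision of the sentence are primitive
  recursive, so that \<open>L\<close> belongs to every class that contains the decision function and is
  closed under composition and primitive recursion.
\<close>

section \<open>Polynomials over a subfield\<close>

lemma subfield_diff: "is_subfield F \<Longrightarrow> x \<in> F \<Longrightarrow> y \<in> F \<Longrightarrow> x - y \<in> F"
  by (metis diff_conv_add_uminus is_subfield_def)

lemma subfield_sum: "is_subfield F \<Longrightarrow> (\<And>i. i \<in> I \<Longrightarrow> f i \<in> F) \<Longrightarrow> sum f I \<in> F"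
  by (induction I rule: infinite_finite_induct) (auto simp: is_subfield_def)

lemma poly_over_iff:
  assumes "is_subfield F"
  shows "poly_over F p \<longleftrightarrow> (\<forall>i. coeff p i \<in> F)"
proof -
  have "range (coeff p) \<subseteq> F \<longleftrightarrow> set (coeffs p) \<subseteq> F"
    using assms by (simp add: range_coeff is_subfield_def)
  then show ?thesis by (simp add: poly_over_def image_subset_iff)
qed

lemma root_imp_degree_pos:
  fixes p :: "'a :: idom poly"
  shows "p \<noteq> 0 \<Longrightarrow> poly p x = 0 \<Longrightarrow> degree p > 0"
  by (rule ccontr) (auto elim!: degree_eq_zeroE)

context
  fixes F :: "'a :: field set"
  assumes F: "is_subfield F"
begin

lemma poly_over_pCons [simp]: "poly_over F (pCons a p) \<longleftrightarrow> a \<in> F \<and> poly_over F p"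
  by (auto simp: poly_over_iff[OF F] coeff_pCons split: nat.splits)

lemma poly_over_0 [simp]: "poly_over F 0"
  by (simp add: poly_over_def)

lemma poly_over_add: "poly_over F p \<Longrightarrow> poly_over F q \<Longrightarrow> poly_over F (p + q)"
  using F by (simp add: poly_over_iff is_subfield_def)

lemma poly_over_diff: "poly_over F p \<Longrightarrow> poly_over F q \<Longrightarrow> poly_over F (p - q)"
  using F by (simp add: poly_over_iff subfield_diff)

lemma poly_over_mult: "poly_over F p \<Longrightarrow> poly_over F q \<Longrightarrow> poly_over F (p * q)"
  using F by (auto simp: poly_over_iff coeff_mult is_subfield_def intro!: subfield_sum)

lemma poly_over_monom: "a \<in> F \<Longrightarrow> poly_over F (monom a n)"
  using F by (simp add: poly_over_iff is_subfield_def)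

lemma poly_in_subfield: "poly_over F p \<Longrightarrow> x \<in> F \<Longrightarrow> poly p x \<in> F"
  using F by (induction p) (auto simp: is_subfield_def)

lemma poly_over_division:
  assumes "poly_over F f" and "poly_over F g" and "g \<noteq> 0"
  shows "\<exists>q r. poly_over F q \<and> poly_over F r \<and> f = g * q + r \<and> (r = 0 \<or> degree r < degree g)"
  using assms(1)
proof (induction "if f = 0 then 0 else Suc (degree f)" arbitrary: f rule: less_induct)
  case less
  show ?case
  proof (cases "f = 0 \<or> degree f < degree g")
    case True
    then show ?thesis using less.prems by (intro exI[of _ 0] exI[of _ f]) auto
  next
    case False
    define c where "c = lead_coeff f * inverse (lead_coeff g)"
    define m where "m = monom c (degree f - degree g)"
    define f' where "f' = f - g * m"
    have c: "c \<in> F" "c \<noteq> 0"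
      using F less.prems assms False by (auto simp: c_def poly_over_iff is_subfield_def)
    have m: "poly_over F m" by (simp add: m_def poly_over_monom c)
    have f': "poly_over F f'" using m less.prems assms by (simp add: f'_def poly_over_diff poly_over_mult)
    have deg: "degree (g * m) = degree f"
      using False assms c by (simp add: m_def degree_mult_eq degree_monom_eq monom_eq_0_iff)
    have lead: "coeff (g * m) (degree f) = lead_coeff f"
    proof -
      have "coeff (g * m) (degree f) = lead_coeff g * lead_coeff m"
        by (metis deg lead_coeff_mult)
      also have "lead_coeff m = c" by (simp add: m_def degree_monom_eq c)
      finally show ?thesis using assms by (simp add: c_def)
    qed
    have "f' = 0 \<or> degree f' < degree f"
    proof -
      have "degree f' \<le> degree f" by (simp add: f'_def deg degree_diff_le)
      moreover have "coeff f' (degree f) = 0" by (simp add: f'_def lead)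
      ultimately show ?thesis
        by (metis eq_zero_or_degree_less)
    qed
    then have "(if f' = 0 then 0 else Suc (degree f')) < (if f = 0 then 0 else Suc (degree f))"
      using False by auto
    from less.hyps[OF this f'] obtain q r where
      "poly_over F q" "poly_over F r" "f' = g * q + r" "r = 0 \<or> degree r < degree g" by blast
    then show ?thesis using m
      by (intro exI[of _ "q + m"] exI[of _ r]) (auto simp: poly_over_add f'_def algebra_simps)
  qed
qed

lemma least_degree_dvd:
  assumes m: "poly_over F m" "m \<noteq> 0" "poly m x = 0"
    and least: "\<And>p. poly_over F p \<Longrightarrow> p \<noteq> 0 \<Longrightarrow> poly p x = 0 \<Longrightarrow> degree m \<le> degree p"
    and q: "poly_over F q" "poly q x = 0"
  shows "\<exists>r. poly_over F r \<and> q = m * r"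
proof -
  obtain s r where sr: "poly_over F s" "poly_over F r" "q = m * s + r" "r = 0 \<or> degree r < degree m"
    using poly_over_division[OF q(1) m(1,2)] by blast
  have "poly r x = 0" using sr(3) m q by simp
  with sr least[of r] have "r = 0" by force
  with sr show ?thesis by auto
qed

lemma least_degree_exists:
  assumes "poly_over F p" "p \<noteq> 0" "poly p x = 0"
  shows "\<exists>m. poly_over F m \<and> m \<noteq> 0 \<and> poly m x = 0 \<and>
    (\<forall>q. poly_over F q \<longrightarrow> q \<noteq> 0 \<longrightarrow> poly q x = 0 \<longrightarrow> degree m \<le> degree q)"
  using exists_least_iff[of "\<lambda>n. \<exists>m. poly_over F m \<and> m \<noteq> 0 \<and> poly m x = 0 \<and> degree m = n"] assms
  by (metis not_le)

lemma irreducible_over_dvd: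
  assumes f: "irreducible_over F f" "poly f x = 0"
    and q: "poly_over F q" "poly q x = 0"
  shows "\<exists>r. poly_over F r \<and> q = f * r"
proof -
  have f0: "poly_over F f" "f \<noteq> 0" using f by (auto simp: irreducible_over_def)
  obtain m where m: "poly_over F m" "m \<noteq> 0" "poly m x = 0"
    "\<And>q. poly_over F q \<Longrightarrow> q \<noteq> 0 \<Longrightarrow> poly q x = 0 \<Longrightarrow> degree m \<le> degree q"
    using least_degree_exists[OF f0 f(2)] by blast
  obtain s where s: "poly_over F s" "f = m * s" using least_degree_dvd[OF m f0(1) f(2)] by blast
  have "degree m \<noteq> 0"
    using root_imp_degree_pos[OF m(2,3)] by simp
  moreover have "degree m = 0 \<or> degree s = 0"
    by (rule f(1)[unfolded irreducible_over_def, THEN conjunct2, THEN conjunct2, rule_format]) (intro conjI m(1) s)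
  ultimately have "degree s = 0" by simp
  with s f0 have "degree f = degree m" by (auto simp: degree_mult_eq)
  with m(4) have "\<And>q. poly_over F q \<Longrightarrow> q \<noteq> 0 \<Longrightarrow> poly q x = 0 \<Longrightarrow> degree f \<le> degree q"
    by metis
  from least_degree_dvd[OF f0 f(2) this q] show ?thesis .
qed

lemma irreducible_over_exists:
  assumes "poly_over F p" "p \<noteq> 0" "poly p x = 0"
  shows "\<exists>f. irreducible_over F f \<and> poly f x = 0"
proof -
  obtain m where m: "poly_over F m" "m \<noteq> 0" "poly m x = 0"
    and least: "\<And>q. poly_over F q \<Longrightarrow> q \<noteq> 0 \<Longrightarrow> poly q x = 0 \<Longrightarrow> degree m \<le> degree q"
    using least_degree_exists[OF assms] by blast
  have "degree m \<noteq> 0"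
    using root_imp_degree_pos[OF m(2,3)] by simp
  moreover have "degree q = 0 \<or> degree r = 0" if "poly_over F q" "poly_over F r" "m = q * r" for q r
  proof -
    have nz: "q \<noteq> 0" "r \<noteq> 0" using that m by auto
    then have "degree m = degree q + degree r" using that by (simp add: degree_mult_eq)
    moreover have "degree m \<le> degree q \<or> degree m \<le> degree r"
      using m(3) that nz least by auto
    ultimately show ?thesis by auto
  qed
  ultimately have "irreducible_over F m"
    unfolding irreducible_over_def using m(1) by (intro conjI allI impI) auto
  then show ?thesis using m by blast
qed

end

section \<open>Homomorphisms over the base field\<close>

definition K_hom :: "'k :: field alg_closure set \<Rightarrow> ('k alg_closure \<Rightarrow> 'k alg_closure) \<Rightarrow> bool" where
  "K_hom F \<phi> \<longleftrightarrow> is_subfield F \<and> range to_ac \<subseteq> F \<and>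
     (\<forall>x\<in>F. \<forall>y\<in>F. \<phi> (x + y) = \<phi> x + \<phi> y \<and> \<phi> (x * y) = \<phi> x * \<phi> y) \<and>
     (\<forall>a. \<phi> (to_ac a) = to_ac a)"

lemma poly_over_map_to_ac: "range to_ac \<subseteq> F \<Longrightarrow> poly_over F (map_poly to_ac p)"
  by (induction p) (auto simp: poly_over_def map_poly_pCons cCons_def)

text \<open>Algebraicity gives closure under inverses for free.\<close>

lemma is_subfield_algebraic:
  fixes G :: "'k :: field alg_closure set"
  assumes K: "range to_ac \<subseteq> G" and closed: "\<And>x y. x \<in> G \<Longrightarrow> y \<in> G \<Longrightarrow> x + y \<in> G \<and> x * y \<in> G"
  shows "is_subfield G"
proof -
  have 0: "0 \<in> G" "1 \<in> G" and m1: "-1 \<in> G" using K by (metis range_subsetD to_ac_0 to_ac_1 to_ac_minus)+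
  have neg: "- x \<in> G" if "x \<in> G" for x
    using closed[OF m1 that] by simp
  have val: "poly (map_poly to_ac p) x \<in> G" if "x \<in> G" for x and p :: "'k poly"
    using K that 0 by (induction p) (auto simp: map_poly_pCons closed image_subset_iff)
  have "inverse x \<in> G" if x: "x \<in> G" for x
  proof (cases "x = 0")
    case False
    obtain p :: "'k poly" where p: "p \<noteq> 0" "poly (map_poly to_ac p) x = 0"
      by (rule alg_closure_algebraic)
    then show ?thesis
    proof (induction p)
      case (pCons a p)
      have eq: "to_ac a + x * poly (map_poly to_ac p) x = 0"
        using pCons.prems by (simp add: map_poly_pCons)
      show ?case
      proof (cases "a = 0")
        case True
        then show ?thesis using pCons eq False by auto
      next
        case nz: False
        have "x * (- poly (map_poly to_ac p) x * to_ac (inverse a)) = (- (x * poly (map_poly to_ac p) x)) * inverse (to_ac a)"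
          by simp
        also have "- (x * poly (map_poly to_ac p) x) = to_ac a"
          using eq by (metis add.inverse_inverse add_eq_0_iff2 add.commute)
        finally have "x * (- poly (map_poly to_ac p) x * to_ac (inverse a)) = 1" using nz by simp
        then have "inverse x = - poly (map_poly to_ac p) x * to_ac (inverse a)"
          by (rule inverse_unique)
        then show ?thesis using val[OF x] K by (auto intro!: closed[THEN conjunct2] neg simp del: to_ac_inverse)
      qed
    qed simp
  qed (simp add: 0)
  then show ?thesis using 0 closed neg by (simp add: is_subfield_def)
qed

lemma is_subfield_adjoin: "is_subfield (adjoin A)"
  by (auto simp: adjoin_def is_subfield_def)

lemma adjoin_superset: "A \<subseteq> adjoin A" "range to_ac \<subseteq> adjoin A"
  by (auto simp: adjoin_def)

lemma adjoin_least: "is_subfield F \<Longrightarrow> range to_ac \<subseteq> F \<Longrightarrow> A \<subseteq> F \<Longrightarrow> adjoin A \<subseteq> F"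
  by (auto simp: adjoin_def)

lemma adjoin_mono: "A \<subseteq> adjoin B \<Longrightarrow> adjoin A \<subseteq> adjoin B"
  by (intro adjoin_least is_subfield_adjoin adjoin_superset)

lemma adjoin_insert_0: "adjoin (insert 0 A) = adjoin A"
proof
  have "0 \<in> adjoin A" using is_subfield_adjoin[of A] by (simp add: is_subfield_def)
  then show "adjoin (insert 0 A) \<subseteq> adjoin A" by (intro adjoin_mono) (auto intro: adjoin_superset(1)[THEN subsetD])
  show "adjoin A \<subseteq> adjoin (insert 0 A)" by (intro adjoin_mono) (use adjoin_superset in blast)
qed

lemma K_hom_subset: "K_hom G \<phi> \<Longrightarrow> is_subfield F \<Longrightarrow> range to_ac \<subseteq> F \<Longrightarrow> F \<subseteq> G \<Longrightarrow> K_hom F \<phi>"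
  unfolding K_hom_def by blast

context
  fixes F :: "'k :: field alg_closure set" and \<phi>
  assumes hom: "K_hom F \<phi>"
begin

lemma K_hom_subfield: "is_subfield F" "range to_ac \<subseteq> F"
  using hom by (auto simp: K_hom_def)

lemma K_hom_0 [simp]: "\<phi> 0 = 0" and K_hom_1 [simp]: "\<phi> 1 = 1"
  using hom by (metis K_hom_def to_ac_0, metis K_hom_def to_ac_1)

lemma K_hom_to_ac [simp]: "\<phi> (to_ac a) = to_ac a"
  using hom by (simp add: K_hom_def)

lemma K_hom_add: "x \<in> F \<Longrightarrow> y \<in> F \<Longrightarrow> \<phi> (x + y) = \<phi> x + \<phi> y"
  and K_hom_mult: "x \<in> F \<Longrightarrow> y \<in> F \<Longrightarrow> \<phi> (x * y) = \<phi> x * \<phi> y"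
  using hom by (auto simp: K_hom_def)

lemma K_hom_minus: "x \<in> F \<Longrightarrow> \<phi> (- x) = - \<phi> x"
  using K_hom_add[of x "- x"] K_hom_subfield by (simp add: is_subfield_def eq_neg_iff_add_eq_0 add.commute)

lemma K_hom_diff: "x \<in> F \<Longrightarrow> y \<in> F \<Longrightarrow> \<phi> (x - y) = \<phi> x - \<phi> y"
  using K_hom_add[of x "- y"] K_hom_subfield by (simp add: K_hom_minus is_subfield_def)

lemma K_hom_sum: "(\<And>i. i \<in> I \<Longrightarrow> f i \<in> F) \<Longrightarrow> \<phi> (sum f I) = (\<Sum>i\<in>I. \<phi> (f i))"
  by (induction I rule: infinite_finite_induct)
     (auto simp: K_hom_add subfield_sum[OF K_hom_subfield(1)])

lemma K_hom_inverse: "x \<in> F \<Longrightarrow> \<phi> (inverse x) = inverse (\<phi> x)"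
proof (cases "x = 0")
  case False
  assume "x \<in> F"
  then have "\<phi> x * \<phi> (inverse x) = \<phi> 1"
    using K_hom_mult[of x "inverse x"] K_hom_subfield False by (simp add: is_subfield_def)
  then show ?thesis by (simp add: inverse_unique)
qed simp

lemma K_hom_inj_on: "inj_on \<phi> F"
proof (rule inj_onI)
  fix x y assume xy: "x \<in> F" "y \<in> F" "\<phi> x = \<phi> y"
  then have d: "x - y \<in> F" "\<phi> (x - y) = 0"
    using subfield_diff[OF K_hom_subfield(1)] by (auto simp: K_hom_diff)
  have "\<phi> ((x - y) * inverse (x - y)) = 0"
    using d K_hom_mult[of "x - y" "inverse (x - y)"] K_hom_subfield by (simp add: is_subfield_def)
  then show "x = y" by (cases "x - y = 0") auto
qed

lemma K_hom_map_add:
  "poly_over F p \<Longrightarrow> poly_over F q \<Longrightarrow> map_poly \<phi> (p + q) = map_poly \<phi> p + map_poly \<phi> q"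
  by (intro poly_eqI) (auto simp: coeff_map_poly K_hom_add poly_over_iff[OF K_hom_subfield(1)])

lemma K_hom_map_diff:
  "poly_over F p \<Longrightarrow> poly_over F q \<Longrightarrow> map_poly \<phi> (p - q) = map_poly \<phi> p - map_poly \<phi> q"
  by (intro poly_eqI) (auto simp: coeff_map_poly K_hom_diff poly_over_iff[OF K_hom_subfield(1)])

lemma K_hom_map_mult:
  assumes "poly_over F p" "poly_over F q"
  shows "map_poly \<phi> (p * q) = map_poly \<phi> p * map_poly \<phi> q"
proof (intro poly_eqI)
  fix n
  have "coeff p i * coeff q j \<in> F" for i j
    using assms K_hom_subfield by (auto simp: poly_over_iff is_subfield_def)
  then show "coeff (map_poly \<phi> (p * q)) n = coeff (map_poly \<phi> p * map_poly \<phi> q) n"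
    using assms by (auto simp: coeff_map_poly coeff_mult K_hom_sum K_hom_mult poly_over_iff[OF K_hom_subfield(1)])
qed

lemma K_hom_map_to_ac: "map_poly \<phi> (map_poly to_ac p) = map_poly to_ac p"
  by (simp add: map_poly_map_poly o_def)

lemma K_hom_poly: "poly_over F p \<Longrightarrow> x \<in> F \<Longrightarrow> \<phi> (poly p x) = poly (map_poly \<phi> p) (\<phi> x)"
  using K_hom_subfield
  by (induction p) (auto simp: map_poly_pCons K_hom_add K_hom_mult poly_in_subfield is_subfield_def)

lemma K_hom_image_subfield: "is_subfield (\<phi> ` F)"
  using K_hom_subfield unfolding is_subfield_def
  by (auto simp flip: K_hom_add K_hom_mult K_hom_minus K_hom_inverse) (metis K_hom_0 K_hom_1 imageI)+

lemma K_hom_image_to_ac: "range to_ac \<subseteq> \<phi> ` F"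
  using K_hom_subfield by (auto intro!: image_eqI[where f = \<phi>])

lemma K_hom_inv_into: "K_hom (\<phi> ` F) (inv_into F \<phi>)"
proof -
  have inv: "inv_into F \<phi> (\<phi> x) = x" if "x \<in> F" for x
    using K_hom_inj_on that by (rule inv_into_f_f)
  have "inv_into F \<phi> (to_ac a) = to_ac a" for a
    using inv[of "to_ac a"] K_hom_subfield by auto
  then show ?thesis
    using K_hom_subfield inv unfolding K_hom_def
    by (simp add: K_hom_image_subfield K_hom_image_to_ac)
       (simp add: is_subfield_def flip: K_hom_add K_hom_mult)
qed

lemma K_hom_vimage_subfield:
  assumes "is_subfield M" "range to_ac \<subseteq> M"
  shows "is_subfield {x \<in> F. \<phi> x \<in> M}"
  using assms K_hom_subfield unfolding is_subfield_def
  by (auto simp: K_hom_add K_hom_mult K_hom_minus K_hom_inverse)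

lemma K_hom_adjoin_image:
  assumes "is_subfield M" "range to_ac \<subseteq> M" "A \<subseteq> F" "\<phi> ` A \<subseteq> M"
  shows "\<phi> ` adjoin A \<subseteq> M"
proof -
  have "adjoin A \<subseteq> {x \<in> F. \<phi> x \<in> M}"
    using assms K_hom_subfield by (intro adjoin_least K_hom_vimage_subfield) auto
  then show ?thesis by auto
qed

lemma K_hom_extend:
  assumes f: "irreducible_over F f" "poly f x = 0" and x': "poly (map_poly \<phi> f) x' = 0"
  shows "\<exists>\<psi>. K_hom (adjoin (insert x F)) \<psi> \<and> \<psi> x = x' \<and> (\<forall>y\<in>F. \<psi> y = \<phi> y)"
proof -
  note F = K_hom_subfield(1)
  have wd: "poly (map_poly \<phi> p) x' = poly (map_poly \<phi> q) x'"
    if "poly_over F p" "poly_over F q" "poly p x = poly q x" for p q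
  proof -
    have "poly_over F (p - q)" "poly (p - q) x = 0" using that F by (auto intro: poly_over_diff)
    then obtain r where r: "poly_over F r" "p - q = f * r"
      using irreducible_over_dvd[OF F f] by blast
    have "map_poly \<phi> p - map_poly \<phi> q = map_poly \<phi> f * map_poly \<phi> r"
      using r f that K_hom_map_mult[of f r] by (simp add: irreducible_over_def flip: K_hom_map_diff)
    from arg_cong[OF this, of "\<lambda>p. poly p x'"] show ?thesis using x' by simp
  qed
  define G where "G = {poly p x |p. poly_over F p}"
  define \<psi> where "\<psi> z = poly (map_poly \<phi> (SOME p. poly_over F p \<and> poly p x = z)) x'" for z
  have \<psi>: "\<psi> (poly p x) = poly (map_poly \<phi> p) x'" if "poly_over F p" for p
  proof -
    have "\<exists>q. poly_over F q \<and> poly q x = poly p x" using that by blast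
    from someI_ex[OF this] show ?thesis unfolding \<psi>_def using wd that by blast
  qed
  have const: "poly_over F [:c:]" if "c \<in> F" for c using that F by simp
  have cG: "c \<in> G" if "c \<in> F" for c
    unfolding G_def using const[OF that] by (intro CollectI exI[of _ "[:c:]"]) simp
  have c\<psi>: "\<psi> c = \<phi> c" if "c \<in> F" for c
    using \<psi>[OF const[OF that]] by (simp add: map_poly_pCons)
  have X: "poly_over F [:0, 1:]" using F by (simp add: is_subfield_def)
  have xG: "x \<in> G" unfolding G_def using X by (intro CollectI exI[of _ "[:0, 1:]"]) simp
  have x\<psi>: "\<psi> x = x'" using \<psi>[OF X] by (simp add: map_poly_pCons)
  have closed: "u + v \<in> G \<and> u * v \<in> G \<and> \<psi> (u + v) = \<psi> u + \<psi> v \<and> \<psi> (u * v) = \<psi> u * \<psi> v"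
    if uv: "u \<in> G" "v \<in> G" for u v
  proof -
    obtain p q where pq: "poly_over F p" "poly_over F q" "u = poly p x" "v = poly q x"
      using uv unfolding G_def by blast
    have s: "poly_over F (p + q)" "poly_over F (p * q)" using pq F by (auto intro: poly_over_add poly_over_mult)
    have "u + v = poly (p + q) x" "u * v = poly (p * q) x" using pq by auto
    moreover from this have "u + v \<in> G" "u * v \<in> G" using s unfolding G_def by blast+
    moreover have "\<psi> (poly (p + q) x) = \<psi> (poly p x) + \<psi> (poly q x)"
      "\<psi> (poly (p * q) x) = \<psi> (poly p x) * \<psi> (poly q x)"
      using \<psi>[OF s(1)] \<psi>[OF s(2)] \<psi>[OF pq(1)] \<psi>[OF pq(2)]
      by (simp_all add: K_hom_map_add K_hom_map_mult pq(1,2))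
    ultimately show ?thesis using pq by simp
  qed
  have K\<psi>: "\<psi> (to_ac a) = to_ac a" for a
    using c\<psi>[of "to_ac a"] K_hom_subfield(2) by auto
  have KG: "range to_ac \<subseteq> G" using cG K_hom_subfield by auto
  have G: "is_subfield G" using closed KG by (intro is_subfield_algebraic) auto
  have hG: "K_hom G \<psi>"
    unfolding K_hom_def using closed KG G K\<psi> by auto
  have "adjoin (insert x F) \<subseteq> G"
    using G KG xG cG by (intro adjoin_least) auto
  then have "K_hom (adjoin (insert x F)) \<psi>"
    by (rule K_hom_subset[OF hG is_subfield_adjoin adjoin_superset(2)])
  then show ?thesis using x\<psi> c\<psi> by (intro exI[of _ \<psi>]) simp
qed

lemma K_hom_extend_exists:
  "\<exists>\<psi>. K_hom (adjoin (insert x F)) \<psi> \<and> (\<forall>y\<in>F. \<psi> y = \<phi> y)"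
proof -
  obtain p :: "'k poly" where p: "p \<noteq> 0" "poly (map_poly to_ac p) x = 0"
    by (rule alg_closure_algebraic)
  have "map_poly to_ac p \<noteq> 0" using p by (simp add: map_poly_eq_0_iff)
  then obtain f where f: "irreducible_over F f" "poly f x = 0"
    using irreducible_over_exists[OF K_hom_subfield(1) poly_over_map_to_ac[OF K_hom_subfield(2)]] p by blast
  have "degree (map_poly \<phi> f) = degree f"
  proof -
    have "lead_coeff f \<in> F" "lead_coeff f \<noteq> 0"
      using f poly_over_iff[OF K_hom_subfield(1)] by (auto simp: irreducible_over_def)
    then have "\<phi> (lead_coeff f) \<noteq> 0"
      using K_hom_inj_on K_hom_subfield by (metis K_hom_0 inj_on_def is_subfield_def)
    then show ?thesis by (intro map_poly_degree_eq)
  qed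
  then have "degree (map_poly \<phi> f) > 0" using f by (simp add: irreducible_over_def)
  then obtain x' where "poly (map_poly \<phi> f) x' = 0"
    using alg_closed_imp_poly_has_root by blast
  then show ?thesis using K_hom_extend[OF f] by blast
qed

end

section \<open>The greedy subfield\<close>

definition embeds :: "'k :: field alg_closure set \<Rightarrow> 'k alg_closure set \<Rightarrow> bool" where
  "embeds M A \<longleftrightarrow> (\<exists>\<phi>. K_hom (adjoin A) \<phi> \<and> \<phi> ` A \<subseteq> M)"

primrec stage :: "('k :: field alg_closure \<Rightarrow> nat) \<Rightarrow> 'k alg_closure set \<Rightarrow> nat \<Rightarrow> 'k alg_closure set" where
  "stage \<nu> M 0 = {}"
| "stage \<nu> M (Suc n) = stage \<nu> M n \<union> {x. \<nu> x = n \<and> embeds M (insert x (stage \<nu> M n))}"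

definition greedy :: "('k :: field alg_closure \<Rightarrow> nat) \<Rightarrow> 'k alg_closure set \<Rightarrow> 'k alg_closure set" where
  "greedy \<nu> M = {x. embeds M (insert x (stage \<nu> M (\<nu> x)))}"

lemma mem_stage_iff: "x \<in> stage \<nu> M n \<longleftrightarrow> \<nu> x < n \<and> x \<in> greedy \<nu> M"
  by (induction n) (auto simp: greedy_def less_Suc_eq)

lemma embeds_subset_adjoin:
  assumes M: "is_subfield M" "range to_ac \<subseteq> M" and "embeds M B" "A \<subseteq> adjoin B"
  shows "embeds M A"
proof -
  obtain \<phi> where \<phi>: "K_hom (adjoin B) \<phi>" "\<phi> ` B \<subseteq> M" using assms by (auto simp: embeds_def)
  have "K_hom (adjoin A) \<phi>"
    using \<phi>(1) is_subfield_adjoin adjoin_superset(2) adjoin_mono[OF assms(4)] by (rule K_hom_subset)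
  moreover have "\<phi> ` adjoin B \<subseteq> M"
    by (rule K_hom_adjoin_image[OF \<phi>(1) M adjoin_superset(1) \<phi>(2)])
  ultimately show ?thesis using assms(4) by (auto simp: embeds_def)
qed

context
  fixes \<nu> :: "'k :: field alg_closure \<Rightarrow> nat" and M :: "'k alg_closure set"
  assumes inj: "inj \<nu>" and M: "is_subfield M" "range to_ac \<subseteq> M"
begin

lemma embeds_stage: "embeds M (stage \<nu> M n)"
proof (induction n)
  case 0
  have "K_hom (adjoin {}) id"
    unfolding K_hom_def using is_subfield_adjoin adjoin_superset(2) by auto
  then show ?case by (auto simp: embeds_def)
next
  case (Suc n)
  show ?case
  proof (cases "\<exists>x. \<nu> x = n \<and> embeds M (insert x (stage \<nu> M n))")
    case True
    then obtain x where x: "\<nu> x = n" "embeds M (insert x (stage \<nu> M n))" by blast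
    then have "stage \<nu> M (Suc n) = insert x (stage \<nu> M n)" using inj by (auto dest: injD)
    then show ?thesis using x by simp
  next
    case False
    then have "stage \<nu> M (Suc n) = stage \<nu> M n" by auto
    then show ?thesis using Suc by simp
  qed
qed

lemma adjoin_stage_subset: "adjoin (stage \<nu> M n) \<subseteq> greedy \<nu> M"
proof
  fix x assume x: "x \<in> adjoin (stage \<nu> M n)"
  define N where "N = max n (\<nu> x)"
  have mono: "stage \<nu> M i \<subseteq> adjoin (stage \<nu> M N)" if "i \<le> N" for i
    using that adjoin_superset(1)[of "stage \<nu> M N"] by (auto simp: mem_stage_iff)
  have "insert x (stage \<nu> M (\<nu> x)) \<subseteq> adjoin (stage \<nu> M N)"
    using x mono[of "\<nu> x"] adjoin_mono[OF mono[of n]] by (auto simp: N_def)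
  then show "x \<in> greedy \<nu> M"
    using embeds_subset_adjoin[OF M embeds_stage] by (simp add: greedy_def)
qed

lemma range_to_ac_greedy: "range to_ac \<subseteq> greedy \<nu> M"
  using adjoin_superset(2) adjoin_stage_subset by blast

lemma is_subfield_greedy: "is_subfield (greedy \<nu> M)"
proof (rule is_subfield_algebraic[OF range_to_ac_greedy])
  fix x y assume xy: "x \<in> greedy \<nu> M" "y \<in> greedy \<nu> M"
  define n where "n = Suc (max (\<nu> x) (\<nu> y))"
  have "x \<in> adjoin (stage \<nu> M n)" "y \<in> adjoin (stage \<nu> M n)"
    using xy by (auto intro!: adjoin_superset(1)[THEN subsetD] simp: mem_stage_iff n_def simp del: stage.simps)
  then have "x + y \<in> adjoin (stage \<nu> M n) \<and> x * y \<in> adjoin (stage \<nu> M n)"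
    using is_subfield_adjoin[of "stage \<nu> M n"] by (simp add: is_subfield_def)
  then show "x + y \<in> greedy \<nu> M \<and> x * y \<in> greedy \<nu> M"
    using adjoin_stage_subset by blast
qed

text \<open>
  Compactness: a diagonal subsequence of the embeddings of the stages converges pointwise.
\<close>

lemma K_hom_greedy: "\<exists>\<sigma>. K_hom (greedy \<nu> M) \<sigma> \<and> \<sigma> ` greedy \<nu> M \<subseteq> M"
proof -
  obtain \<phi> where \<phi>: "\<And>n. K_hom (adjoin (stage \<nu> M n)) (\<phi> n)" "\<And>n. \<phi> n ` stage \<nu> M n \<subseteq> M"
    using embeds_stage unfolding embeds_def by metis
  define g where "g n x = (if x \<in> stage \<nu> M n then \<phi> n x else 0)" for n x
  have fin: "finite (range (\<lambda>n. g n x))" for x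
  proof -
    obtain p :: "'k poly" where p: "p \<noteq> 0" "poly (map_poly to_ac p) x = 0"
      by (rule alg_closure_algebraic)
    have "poly (map_poly to_ac p) (\<phi> n x) = 0" if "x \<in> stage \<nu> M n" for n
    proof -
      have x: "x \<in> adjoin (stage \<nu> M n)" using that adjoin_superset(1) by blast
      have "\<phi> n (poly (map_poly to_ac p) x) = poly (map_poly to_ac p) (\<phi> n x)"
        using K_hom_poly[OF \<phi>(1) poly_over_map_to_ac[OF adjoin_superset(2)] x]
        by (simp add: K_hom_map_to_ac[OF \<phi>(1)])
      then show ?thesis using p K_hom_0[OF \<phi>(1)] by simp
    qed
    then have "range (\<lambda>n. g n x) \<subseteq> insert 0 {y. poly (map_poly to_ac p) y = 0}"
      by (auto simp: g_def)
    moreover have "map_poly to_ac p \<noteq> 0" using p by (simp add: map_poly_eq_0_iff)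
    ultimately show ?thesis
      by (metis finite_insert finite_subset poly_roots_finite)
  qed
  define P where "P k s \<longleftrightarrow> (\<forall>x. \<nu> x = k \<longrightarrow> (\<exists>c. \<forall>m. g (s m) x = c))" for k and s :: "nat \<Rightarrow> nat"
  interpret subseqs P
  proof
    fix k and s :: "nat \<Rightarrow> nat" assume s: "strict_mono s"
    show "\<exists>r. strict_mono r \<and> P k (s \<circ> r)"
    proof (cases "k \<in> range \<nu>")
      case True
      then obtain x where x: "k = \<nu> x" by blast
      have "finite (range (\<lambda>m. g (s m) x))"
        by (rule finite_subset[OF _ fin[of x]]) auto
      then obtain c where "infinite {m. g (s m) x = g (s c) x}"
        using pigeonhole_infinite[of UNIV "\<lambda>m. g (s m) x"] by auto
      then obtain r :: "nat \<Rightarrow> nat" where r: "strict_mono r" "\<And>n. r n \<in> {m. g (s m) x = g (s c) x}"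
        using infinite_enumerate by blast
      then have "P k (s \<circ> r)" using x inj by (auto simp: P_def dest: injD)
      then show ?thesis using r by blast
    next
      case False
      then show ?thesis by (intro exI[of _ id]) (auto simp: P_def strict_mono_def)
    qed
  qed
  define d where "d = diagseq"
  have lim: "\<exists>c. \<exists>N. \<forall>m\<ge>N. g (d m) x = c" for x
  proof -
    have "P (\<nu> x) (d \<circ> ((+) (Suc (\<nu> x))))"
      unfolding d_def by (rule diagseq_holds) (auto simp: P_def)
    then obtain c where c: "\<And>m. g (d (Suc (\<nu> x) + m)) x = c" by (auto simp: P_def)
    have "g (d m) x = c" if "m \<ge> Suc (\<nu> x)" for m
      using c[of "m - Suc (\<nu> x)"] that by simp
    then show ?thesis by blast
  qed
  then obtain \<sigma> where \<sigma>: "\<And>x. \<exists>N. \<forall>m\<ge>N. g (d m) x = \<sigma> x" by metis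
  have ev: "\<forall>\<^sub>F m in sequentially. x \<in> stage \<nu> M (d m) \<and> \<phi> (d m) x = \<sigma> x" if "x \<in> greedy \<nu> M" for x
  proof -
    obtain N where N: "\<And>m. m \<ge> N \<Longrightarrow> g (d m) x = \<sigma> x" using \<sigma> by blast
    have "x \<in> stage \<nu> M (d m) \<and> \<phi> (d m) x = \<sigma> x" if m: "m \<ge> max N (Suc (\<nu> x))" for m
    proof -
      have "m \<le> d m" unfolding d_def by (rule seq_suble[OF subseq_diagseq])
      then have "x \<in> stage \<nu> M (d m)" using \<open>x \<in> greedy \<nu> M\<close> m by (auto simp: mem_stage_iff)
      then show ?thesis using N[of m] m by (simp add: g_def)
    qed
    then show ?thesis unfolding eventually_sequentially by blast
  qed
  have ex: "\<exists>n. \<forall>x\<in>A. x \<in> stage \<nu> M n \<and> \<phi> n x = \<sigma> x"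
    if "finite A" "A \<subseteq> greedy \<nu> M" for A
  proof -
    have "\<forall>\<^sub>F m in sequentially. \<forall>x\<in>A. x \<in> stage \<nu> M (d m) \<and> \<phi> (d m) x = \<sigma> x"
      using that ev by (simp add: eventually_ball_finite subset_iff)
    from eventually_happens'[OF sequentially_bot this] show ?thesis by blast
  qed
  note L = is_subfield_greedy[unfolded is_subfield_def] range_to_ac_greedy
  have "\<sigma> (x + y) = \<sigma> x + \<sigma> y \<and> \<sigma> (x * y) = \<sigma> x * \<sigma> y"
    if xy: "x \<in> greedy \<nu> M" "y \<in> greedy \<nu> M" for x y
  proof -
    obtain n where n: "\<forall>z\<in>{x, y, x + y, x * y}. z \<in> stage \<nu> M n \<and> \<phi> n z = \<sigma> z"
      using ex[of "{x, y, x + y, x * y}"] xy L by auto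
    then have "x \<in> adjoin (stage \<nu> M n)" "y \<in> adjoin (stage \<nu> M n)"
      using adjoin_superset(1)[of "stage \<nu> M n"] by auto
    then show ?thesis using n K_hom_add[OF \<phi>(1)] K_hom_mult[OF \<phi>(1)] by fastforce
  qed
  moreover have "\<sigma> (to_ac a) = to_ac a" for a
    using ex[of "{to_ac a}"] L(2) K_hom_to_ac[OF \<phi>(1)] by fastforce
  ultimately have "K_hom (greedy \<nu> M) \<sigma>"
    unfolding K_hom_def using is_subfield_greedy L(2) by blast
  moreover have "\<sigma> ` greedy \<nu> M \<subseteq> M"
  proof
    fix z assume "z \<in> \<sigma> ` greedy \<nu> M"
    then obtain x where "x \<in> greedy \<nu> M" "z = \<sigma> x" by blast
    then show "z \<in> M" using ex[of "{x}"] \<phi>(2) by fastforce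
  qed
  ultimately show ?thesis by blast
qed

lemma K_isomorphic_greedy: "K_isomorphic M (greedy \<nu> M)"
proof -
  let ?L = "greedy \<nu> M"
  obtain \<sigma> where \<sigma>: "K_hom ?L \<sigma>" "\<sigma> ` ?L \<subseteq> M" using K_hom_greedy by blast
  have "x \<in> \<sigma> ` ?L" if x: "x \<in> M" for x
  proof -
    define E where "E = adjoin (insert x (\<sigma> ` ?L))"
    obtain \<psi> where \<psi>: "K_hom E \<psi>" "\<forall>y\<in>\<sigma> ` ?L. \<psi> y = inv_into ?L \<sigma> y"
      using K_hom_extend_exists[OF K_hom_inv_into[OF \<sigma>(1)]] unfolding E_def by blast
    define \<chi> where "\<chi> = inv_into E \<psi>"
    have \<chi>: "K_hom (\<psi> ` E) \<chi>" unfolding \<chi>_def by (rule K_hom_inv_into[OF \<psi>(1)])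
    have xE: "x \<in> E" and LE: "\<sigma> ` ?L \<subseteq> E" 
      using adjoin_superset(1)[of "insert x (\<sigma> ` ?L)"] by (auto simp: E_def)
    define y where "y = \<psi> x"
    have y: "y \<in> \<psi> ` E" "\<chi> y = x"
      using xE inv_into_f_f[OF K_hom_inj_on[OF \<psi>(1)] xE] by (auto simp: y_def \<chi>_def)
    have z: "z \<in> \<psi> ` E \<and> \<chi> z = \<sigma> z" if "z \<in> ?L" for z
    proof -
      have sE: "\<sigma> z \<in> E" using that LE by blast
      have "\<psi> (\<sigma> z) = z" using \<psi>(2) that inv_into_f_f[OF K_hom_inj_on[OF \<sigma>(1)] that] by simp
      then show ?thesis using inv_into_f_f[OF K_hom_inj_on[OF \<psi>(1)] sE] sE by (auto simp: \<chi>_def intro: rev_image_eqI)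
    qed
    have S: "insert y (stage \<nu> M (\<nu> y)) \<subseteq> \<psi> ` E" using y z by (auto simp: mem_stage_iff)
    have "K_hom (adjoin (insert y (stage \<nu> M (\<nu> y)))) \<chi>"
      using \<chi> is_subfield_adjoin adjoin_superset(2)
        adjoin_least[OF K_hom_subfield[OF \<chi>] S] by (rule K_hom_subset)
    moreover have "\<chi> ` insert y (stage \<nu> M (\<nu> y)) \<subseteq> M"
      using y z x \<sigma>(2) by (auto simp: mem_stage_iff)
    ultimately have "y \<in> ?L" by (auto simp: greedy_def embeds_def)
    then show ?thesis using z y by force
  qed
  then have im: "\<sigma> ` ?L = M" using \<sigma>(2) by blast
  have "bij_betw (inv_into ?L \<sigma>) M ?L"
    using K_hom_inj_on[OF \<sigma>(1)] im by (intro bij_betw_inv_into) (simp add: bij_betw_def)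
  then show ?thesis
    using K_hom_inv_into[OF \<sigma>(1)] unfolding im K_hom_def K_isomorphic_def by blast
qed

end

section \<open>Towers and existential sentences\<close>

lemma eval_rterm_cong: "(\<And>i. i \<in> rterm_vars t \<Longrightarrow> \<rho> i = \<rho>' i) \<Longrightarrow> eval_rterm \<rho> t = eval_rterm \<rho>' t"
  by (induction t) auto

lemma spec_poly_cong:
  assumes "coeffs_vars_below n cs" "\<And>i. i < n \<Longrightarrow> \<rho> i = \<rho>' i"
  shows "spec_poly \<rho> cs = spec_poly \<rho>' cs"
proof -
  have "map (eval_rterm \<rho>) cs = map (eval_rterm \<rho>') cs"
    using assms by (auto simp: coeffs_vars_below_def subset_iff intro!: eval_rterm_cong)
  then show ?thesis by (simp only: spec_poly_def)
qed

lemma root_tower_cong: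
  assumes "root_tower \<rho> fs" "\<And>i. i < length fs \<Longrightarrow> \<rho> i = \<rho>' i"
  shows "root_tower \<rho>' fs"
  unfolding root_tower_def
proof (intro allI impI)
  fix i assume i: "i < length fs"
  have t: "coeffs_vars_below i (fs ! i)" using assms(1) i by (simp add: root_tower_def)
  have "spec_poly \<rho>' (fs ! i) = spec_poly \<rho> (fs ! i)"
    using assms(2) i by (intro spec_poly_cong[OF t]) auto
  moreover have "\<rho>' ` {..<i} = \<rho> ` {..<i}" using assms(2) i by (auto intro!: image_cong)
  moreover have "\<rho>' i = \<rho> i" using assms(2) i by simp
  ultimately show "coeffs_vars_below i (fs ! i) \<and>
     lead_coeff (spec_poly \<rho>' (fs ! i)) = 1 \<and>
     irreducible_over (adjoin (\<rho>' ` {..<i})) (spec_poly \<rho>' (fs ! i)) \<and>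
     poly (spec_poly \<rho>' (fs ! i)) (\<rho>' i) = 0"
    using assms(1) i unfolding root_tower_def by simp
qed

lemma root_tower_snoc:
  "root_tower \<rho> (fs @ [h]) \<longleftrightarrow> root_tower \<rho> fs \<and> coeffs_vars_below (length fs) h \<and>
     lead_coeff (spec_poly \<rho> h) = 1 \<and>
     irreducible_over (adjoin (\<rho> ` {..<length fs})) (spec_poly \<rho> h) \<and>
     poly (spec_poly \<rho> h) (\<rho> (length fs)) = 0"
proof -
  have "root_tower \<rho> (fs @ [h]) \<longleftrightarrow>
    (\<forall>i<length fs. coeffs_vars_below i ((fs @ [h]) ! i) \<and>
     lead_coeff (spec_poly \<rho> ((fs @ [h]) ! i)) = 1 \<and>
     irreducible_over (adjoin (\<rho> ` {..<i})) (spec_poly \<rho> ((fs @ [h]) ! i)) \<and>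
     poly (spec_poly \<rho> ((fs @ [h]) ! i)) (\<rho> i) = 0) \<and>
    coeffs_vars_below (length fs) ((fs @ [h]) ! length fs) \<and>
     lead_coeff (spec_poly \<rho> ((fs @ [h]) ! length fs)) = 1 \<and>
     irreducible_over (adjoin (\<rho> ` {..<length fs})) (spec_poly \<rho> ((fs @ [h]) ! length fs)) \<and>
     poly (spec_poly \<rho> ((fs @ [h]) ! length fs)) (\<rho> (length fs)) = 0"
    unfolding root_tower_def length_append_singleton All_less_Suc2 less_Suc_eq by blast
  then show ?thesis unfolding root_tower_def by (simp add: nth_append cong: conj_cong)
qed

lemma K_hom_eval:
  assumes hom: "K_hom F \<phi>" and "\<And>i. i \<in> rterm_vars t \<Longrightarrow> \<rho> i \<in> F \<and> \<phi> (\<rho> i) = \<rho>' i"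
  shows "eval_rterm \<rho> t \<in> F \<and> \<phi> (eval_rterm \<rho> t) = eval_rterm \<rho>' t"
  using assms(2)
proof (induction t)
  case (Const a)
  then show ?case using K_hom_subfield(2)[OF hom] K_hom_to_ac[OF hom] by auto
next
  case (Neg t)
  then show ?case using K_hom_subfield(1)[OF hom] by (simp add: is_subfield_def K_hom_minus[OF hom])
next
  case (Add s t)
  then show ?case using K_hom_subfield(1)[OF hom] by (simp add: is_subfield_def K_hom_add[OF hom])
next
  case (Mul s t)
  then show ?case using K_hom_subfield(1)[OF hom] by (simp add: is_subfield_def K_hom_mult[OF hom])
qed auto

lemma K_hom_map_spec_poly:
  assumes hom: "K_hom F \<phi>" and vars: "coeffs_vars_below n cs"
    and "\<And>i. i < n \<Longrightarrow> \<rho> i \<in> F \<and> \<phi> (\<rho> i) = \<rho>' i"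
  shows "map_poly \<phi> (spec_poly \<rho> cs) = spec_poly \<rho>' cs"
proof -
  have "\<phi> (eval_rterm \<rho> t) = eval_rterm \<rho>' t" if "t \<in> set cs" for t
    using that vars assms(3) by (auto simp: coeffs_vars_below_def subset_iff intro!: K_hom_eval[OF hom, THEN conjunct2])
  then show ?thesis
    by (intro poly_eqI) (simp add: coeff_map_poly K_hom_0[OF hom] spec_poly_def nth_default_def)
qed

definition horner :: "nat \<Rightarrow> 'k :: field rterm list \<Rightarrow> 'k rterm" where
  "horner i f = foldr (\<lambda>t r. Add t (Mul (Var i) r)) f (Const 0)"

lemma eval_horner: "eval_rterm \<rho> (horner i f) = poly (spec_poly \<rho> f) (\<rho> i)"
  by (induction f) (auto simp: horner_def spec_poly_def)

lemma adjoin_less_Suc: "adjoin (\<rho> ` {..<Suc k}) \<subseteq> adjoin (insert (\<rho> k) (adjoin (\<rho> ` {..<k})))"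
proof (rule adjoin_mono, rule)
  fix x assume "x \<in> \<rho> ` {..<Suc k}"
  then have "x \<in> insert (\<rho> k) (adjoin (\<rho> ` {..<k}))"
    using adjoin_superset(1)[of "\<rho> ` {..<k}"] by (auto simp: less_Suc_eq image_subset_iff)
  then show "x \<in> adjoin (insert (\<rho> k) (adjoin (\<rho> ` {..<k})))" using adjoin_superset(1) by blast
qed

lemma root_tower_K_hom:
  assumes tower: "root_tower \<rho> fs" and roots: "\<And>i. i < length fs \<Longrightarrow> poly (spec_poly \<rho>' (fs ! i)) (\<rho>' i) = 0"
  shows "k \<le> length fs \<Longrightarrow> \<exists>\<phi>. K_hom (adjoin (\<rho> ` {..<k})) \<phi> \<and> (\<forall>i<k. \<phi> (\<rho> i) = \<rho>' i)"
proof (induction k)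
  case 0
  have "K_hom (adjoin {}) id"
    unfolding K_hom_def using is_subfield_adjoin adjoin_superset(2) by auto
  then show ?case by auto
next
  case (Suc k)
  let ?F = "adjoin (\<rho> ` {..<k})"
  obtain \<phi> where \<phi>: "K_hom ?F \<phi>" "\<forall>i<k. \<phi> (\<rho> i) = \<rho>' i" using Suc by auto
  have mem: "\<rho> i \<in> ?F" if "i < k" for i using adjoin_superset(1)[of "\<rho> ` {..<k}"] that by auto
  have f: "coeffs_vars_below k (fs ! k)" "irreducible_over ?F (spec_poly \<rho> (fs ! k))"
    "poly (spec_poly \<rho> (fs ! k)) (\<rho> k) = 0"
    using tower Suc.prems by (auto simp: root_tower_def)
  have "map_poly \<phi> (spec_poly \<rho> (fs ! k)) = spec_poly \<rho>' (fs ! k)"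
    by (rule K_hom_map_spec_poly[OF \<phi>(1) f(1)]) (use \<phi>(2) mem in auto)
  then have "poly (map_poly \<phi> (spec_poly \<rho> (fs ! k))) (\<rho>' k) = 0" using roots Suc.prems by simp
  from K_hom_extend[OF \<phi>(1) f(2,3) this]
  obtain \<psi> where \<psi>: "K_hom (adjoin (insert (\<rho> k) ?F)) \<psi>" "\<psi> (\<rho> k) = \<rho>' k" "\<forall>y\<in>?F. \<psi> y = \<phi> y"
    by blast
  have "K_hom (adjoin (\<rho> ` {..<Suc k})) \<psi>"
    by (rule K_hom_subset[OF \<psi>(1) is_subfield_adjoin adjoin_superset(2) adjoin_less_Suc])
  moreover have "\<forall>i<Suc k. \<psi> (\<rho> i) = \<rho>' i" using \<psi> \<phi> mem by (auto simp: less_Suc_eq)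
  ultimately show ?case by blast
qed

lemma holds_in_root_tower_iff:
  assumes M: "is_subfield M" and tower: "root_tower \<rho> fs"
    and C: "set C = (\<lambda>i. horner i (fs ! i)) ` {..<length fs}"
  shows "holds_in M [C] \<longleftrightarrow> embeds M (\<rho> ` {..<length fs})"
proof
  assume "holds_in M [C]"
  then obtain \<rho>' where \<rho>': "range \<rho>' \<subseteq> M" "\<forall>i<length fs. eval_rterm \<rho>' (horner i (fs ! i)) = 0"
    using C by (auto simp: holds_in_def)
  obtain \<phi> where \<phi>: "K_hom (adjoin (\<rho> ` {..<length fs})) \<phi>" "\<forall>i<length fs. \<phi> (\<rho> i) = \<rho>' i"
    using root_tower_K_hom[OF tower, of \<rho>' "length fs"] \<rho>'(2) by (auto simp: eval_horner)
  then show "embeds M (\<rho> ` {..<length fs})"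
    unfolding embeds_def using \<rho>'(1) by (intro exI[of _ \<phi>]) auto
next
  assume "embeds M (\<rho> ` {..<length fs})"
  then obtain \<phi> where \<phi>: "K_hom (adjoin (\<rho> ` {..<length fs})) \<phi>" "\<phi> ` \<rho> ` {..<length fs} \<subseteq> M"
    by (auto simp: embeds_def)
  define \<rho>' where "\<rho>' i = (if i < length fs then \<phi> (\<rho> i) else 0)" for i
  have mem: "\<rho> i \<in> adjoin (\<rho> ` {..<length fs})" if "i < length fs" for i
    using adjoin_superset(1)[of "\<rho> ` {..<length fs}"] that by auto
  have "poly (spec_poly \<rho>' (fs ! i)) (\<rho>' i) = 0" if i: "i < length fs" for i
  proof -
    have "coeffs_vars_below i (fs ! i)" and root: "poly (spec_poly \<rho> (fs ! i)) (\<rho> i) = 0"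
      and "poly_over (adjoin (\<rho> ` {..<i})) (spec_poly \<rho> (fs ! i))"
      using tower i by (auto simp: root_tower_def irreducible_over_def)
    moreover have "adjoin (\<rho> ` {..<i}) \<subseteq> adjoin (\<rho> ` {..<length fs})"
      using i mem by (intro adjoin_mono) auto
    ultimately have over: "poly_over (adjoin (\<rho> ` {..<length fs})) (spec_poly \<rho> (fs ! i))"
      and map: "map_poly \<phi> (spec_poly \<rho> (fs ! i)) = spec_poly \<rho>' (fs ! i)"
      using mem i by (auto simp: poly_over_def \<rho>'_def intro!: K_hom_map_spec_poly[OF \<phi>(1)])
    have "poly (spec_poly \<rho>' (fs ! i)) (\<phi> (\<rho> i)) = \<phi> 0"
      using K_hom_poly[OF \<phi>(1) over mem[OF i]] root map by simp
    then show ?thesis using i K_hom_0[OF \<phi>(1)] by (simp add: \<rho>'_def)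
  qed
  moreover have "range \<rho>' \<subseteq> M" using \<phi>(2) M by (auto simp: \<rho>'_def is_subfield_def)
  ultimately show "holds_in M [C]" unfolding holds_in_def using C by (intro exI[of _ \<rho>']) (simp add: eval_horner)
qed

section \<open>Closure under primitive recursion\<close>

locale primrec_closed =
  fixes P :: "nat \<Rightarrow> (nat list \<Rightarrow> nat) \<Rightarrow> bool"
  assumes zero: "P n (\<lambda>_. 0)"
    and succ: "P 1 (\<lambda>xs. Suc (hd xs))"
    and proj: "i < n \<Longrightarrow> P n (\<lambda>xs. xs ! i)"
    and comp: "P (length gs) f \<Longrightarrow> (\<And>g. g \<in> set gs \<Longrightarrow> P n g) \<Longrightarrow>
      P n (\<lambda>xs. f (map (\<lambda>g. g xs) gs))"
    and prec: "P n f \<Longrightarrow> P (Suc (Suc n)) g \<Longrightarrow>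
      P (Suc n) (\<lambda>xs. rec_nat (f (tl xs)) (\<lambda>k r. g (k # r # tl xs)) (hd xs))"
begin

lemma primrec_list_closed: "primrec_list n f \<Longrightarrow> P n f"
  by (induction rule: primrec_list.induct) (auto intro: zero succ[simplified] proj comp prec)

definition comput :: "nat \<Rightarrow> (nat list \<Rightarrow> nat) \<Rightarrow> bool" where
  "comput n f \<longleftrightarrow> (\<exists>g. P n g \<and> (\<forall>xs. length xs = n \<longrightarrow> f xs = g xs))"

lemma comput_cong: "comput n f \<Longrightarrow> (\<And>xs. length xs = n \<Longrightarrow> f xs = g xs) \<Longrightarrow> comput n g"
  unfolding comput_def by metis

lemma comput_comp:
  assumes "comput (length gs) f" and "\<And>g. g \<in> set gs \<Longrightarrow> comput n g"
  shows "comput n (\<lambda>xs. f (map (\<lambda>g. g xs) gs))"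
proof -
  obtain f' where f': "P (length gs) f'" "\<And>xs. length xs = length gs \<Longrightarrow> f xs = f' xs"
    using assms(1) unfolding comput_def by blast
  obtain c where c: "\<And>g. g \<in> set gs \<Longrightarrow> P n (c g) \<and> (\<forall>xs. length xs = n \<longrightarrow> g xs = c g xs)"
    using assms(2) unfolding comput_def by metis
  have "P n (\<lambda>xs. f' (map (\<lambda>g. g xs) (map c gs)))"
    using f' c by (intro comp) auto
  moreover have "f (map (\<lambda>g. g xs) gs) = f' (map (\<lambda>g. g xs) (map c gs))" if "length xs = n" for xs
    using f'(2)[of "map (\<lambda>g. g xs) gs"] c that by (simp add: o_def cong: map_cong)
  ultimately show ?thesis unfolding comput_def by blast
qed

lemma comput_nth: "i < n \<Longrightarrow> comput n (\<lambda>xs. xs ! i)"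
  unfolding comput_def using proj by blast

lemma comput_comp1:
  assumes "comput 1 (\<lambda>xs. f (hd xs))" and "comput n g"
  shows "comput n (\<lambda>xs. f (g xs))"
  using comput_comp[of "[g]" "\<lambda>xs. f (hd xs)"] assms by simp

lemma comput_Suc: "comput n a \<Longrightarrow> comput n (\<lambda>xs. Suc (a xs))"
  by (rule comput_comp1) (use succ in \<open>auto simp: comput_def\<close>)

lemma comput_const: "comput n (\<lambda>_. c)"
proof (induction c)
  case 0
  show ?case unfolding comput_def using zero by blast
qed (rule comput_Suc)

lemma comput_tl_tl:
  assumes "comput n f"
  shows "comput (Suc (Suc n)) (\<lambda>xs. f (tl (tl xs)))"
proof (rule comput_cong)
  show "comput (Suc (Suc n)) (\<lambda>xs. f (map (\<lambda>g. g xs) (map (\<lambda>i xs. xs ! Suc (Suc i)) [0..<n])))"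
    by (rule comput_comp) (auto intro: comput_nth assms)
  fix xs :: "nat list" assume xs: "length xs = Suc (Suc n)"
  then have "map (\<lambda>g. g xs) (map (\<lambda>i xs. xs ! Suc (Suc i)) [0..<n]) = tl (tl xs)"
    by (intro nth_equalityI) (auto simp: nth_tl)
  then show "f (map (\<lambda>g. g xs) (map (\<lambda>i xs. xs ! Suc (Suc i)) [0..<n])) = f (tl (tl xs))"
    by simp
qed

lemma comput_rec:
  assumes "comput n m" and "comput n a" and "comput (Suc (Suc n)) b"
  shows "comput n (\<lambda>xs. rec_nat (a xs) (\<lambda>k r. b (k # r # xs)) (m xs))"
proof -
  obtain a' b' where a': "P n a'" "\<And>xs. length xs = n \<Longrightarrow> a xs = a' xs"
    and b': "P (Suc (Suc n)) b'" "\<And>xs. length xs = Suc (Suc n) \<Longrightarrow> b xs = b' xs"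
    using assms(2,3) unfolding comput_def by blast
  let ?R = "\<lambda>xs. rec_nat (a' (tl xs)) (\<lambda>k r. b' (k # r # tl xs)) (hd xs)"
  let ?gs = "m # map (\<lambda>i xs. xs ! i) [0..<n]"
  show ?thesis
  proof (rule comput_cong)
    show "comput n (\<lambda>xs. ?R (map (\<lambda>g. g xs) ?gs))"
    proof (rule comput_comp)
      show "comput (length ?gs) ?R" using prec[OF a'(1) b'(1)] by (auto simp: comput_def)
    qed (use assms(1) comput_nth in auto)
    fix xs :: "nat list" assume xs: "length xs = n"
    then have id: "map (\<lambda>g. g xs) ?gs = m xs # xs" by (auto intro: nth_equalityI)
    show "?R (map (\<lambda>g. g xs) ?gs) = rec_nat (a xs) (\<lambda>k r. b (k # r # xs)) (m xs)"
      unfolding id using a'(2)[OF xs] b'(2) xs by simp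
  qed
qed

lemma comput_add:
  assumes "comput n a" "comput n b"
  shows "comput n (\<lambda>xs. a xs + b xs)"
proof -
  have "comput n (\<lambda>xs. rec_nat (b xs) (\<lambda>k r. (\<lambda>ys. Suc (ys ! 1)) (k # r # xs)) (a xs))"
    by (intro comput_rec comput_Suc comput_nth assms) auto
  moreover have "rec_nat y (\<lambda>k r. Suc r) x = x + y" for x y by (induction x) auto
  ultimately show ?thesis by simp
qed

lemma comput_diff:
  assumes "comput n a" "comput n b"
  shows "comput n (\<lambda>xs. a xs - b xs)"
proof -
  have pred: "comput k (\<lambda>xs. c xs - 1)" if "comput k c" for k c
  proof -
    have "comput k (\<lambda>xs. rec_nat 0 (\<lambda>k r. (\<lambda>ys. ys ! 0) (k # r # xs)) (c xs))"
      by (intro comput_rec comput_const comput_nth that) auto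
    moreover have "rec_nat 0 (\<lambda>k r. k) x = x - 1" for x :: nat by (cases x) auto
    ultimately show ?thesis by simp
  qed
  have "comput n (\<lambda>xs. rec_nat (a xs) (\<lambda>k r. (\<lambda>ys. ys ! 1 - 1) (k # r # xs)) (b xs))"
    by (intro comput_rec comput_nth assms pred) auto
  moreover have "rec_nat x (\<lambda>k r. r - 1) y = x - y" for x y :: nat by (induction y) auto
  ultimately show ?thesis by simp
qed

lemma comput_if_eq:
  assumes "comput n a" "comput n b" "comput n c" "comput n d"
  shows "comput n (\<lambda>xs. if a xs = b xs then c xs else d xs)"
proof -
  have "comput n (\<lambda>xs. rec_nat (c xs) (\<lambda>k r. (\<lambda>ys. d (tl (tl ys))) (k # r # xs)) ((a xs - b xs) + (b xs - a xs)))"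
    by (intro comput_rec comput_add comput_diff comput_tl_tl assms)
  moreover have "rec_nat u (\<lambda>k r. v) ((x - y) + (y - x)) = (if x = y then u else v)" for u v x y :: nat
    by (cases "(x - y) + (y - x)") auto
  ultimately show ?thesis by simp
qed

lemma comput_triangle:
  assumes "comput n a"
  shows "comput n (\<lambda>xs. triangle (a xs))"
proof -
  have "comput n (\<lambda>xs. rec_nat 0 (\<lambda>k r. (\<lambda>ys. ys ! 1 + Suc (ys ! 0)) (k # r # xs)) (a xs))"
    by (intro comput_rec comput_const comput_add comput_Suc comput_nth assms) auto
  moreover have "rec_nat 0 (\<lambda>k r. r + Suc k) x = triangle x" for x by (induction x) auto
  ultimately show ?thesis by simp
qed

text \<open>The index \<open>k\<close> of the diagonal \<open>fst + snd = k\<close> through \<open>prod_decode n\<close>.\<close>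

lemma diagonal_rec:
  fixes n :: nat
  defines "k \<equiv> rec_nat 0 (\<lambda>i r. if triangle (Suc r) - Suc i = 0 then Suc r else r) n"
  shows "fst (prod_decode n) = n - triangle k" and "snd (prod_decode n) = k - fst (prod_decode n)"
proof -
  have bounds: "triangle k \<le> n \<and> n < triangle (Suc k)"
    unfolding k_def by (induction n) (auto simp: Let_def)
  define m where "m = n - triangle k"
  have "n = prod_encode (m, k - m)" using bounds by (auto simp: prod_encode_def m_def)
  then have "prod_decode n = (m, k - m)" by (metis prod_encode_inverse)
  then show "fst (prod_decode n) = n - triangle k" "snd (prod_decode n) = k - fst (prod_decode n)"
    by (auto simp: m_def)
qed

lemma comput_prod_decode:
  assumes "comput n a"
  shows "comput n (\<lambda>xs. fst (prod_decode (a xs)))" "comput n (\<lambda>xs. snd (prod_decode (a xs)))"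
proof -
  have "comput n (\<lambda>xs. rec_nat 0 (\<lambda>k r. (\<lambda>ys. if triangle (Suc (ys ! 1)) - Suc (ys ! 0) = 0 then Suc (ys ! 1) else ys ! 1) (k # r # xs)) (a xs))"
    by (intro comput_rec comput_const comput_if_eq comput_diff comput_triangle comput_Suc comput_nth assms) auto
  then have k: "comput n (\<lambda>xs. rec_nat 0 (\<lambda>i r. if triangle (Suc r) - Suc i = 0 then Suc r else r) (a xs))"
    by (simp cong: if_cong)
  show 1: "comput n (\<lambda>xs. fst (prod_decode (a xs)))"
    unfolding diagonal_rec(1) using comput_diff[OF assms comput_triangle[OF k]] by simp
  show "comput n (\<lambda>xs. snd (prod_decode (a xs)))"
    unfolding diagonal_rec(2) using comput_diff[OF k 1] by simp
qed

text \<open>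
  From here on functions have a single argument; several arguments, and the arguments
  \<open>(x, k, r)\<close> of the step function of a recursion, are combined by \<open>prod_encode\<close>.
\<close>

definition comp1 :: "(nat \<Rightarrow> nat) \<Rightarrow> bool" where
  "comp1 f \<longleftrightarrow> comput 1 (\<lambda>xs. f (hd xs))"

lemma comp1_iff: "comp1 f \<longleftrightarrow> (\<exists>g. P 1 g \<and> (\<forall>x. f x = g [x]))"
proof -
  have "(\<forall>xs. length xs = 1 \<longrightarrow> f (hd xs) = g xs) \<longleftrightarrow> (\<forall>x. f x = g [x])" for g
    by (auto simp: length_Suc_conv)
  then show ?thesis by (simp add: comp1_def comput_def)
qed

lemma primrec_fun_comp1: "primrec_fun f \<Longrightarrow> comp1 f"
  unfolding primrec_fun_def comp1_iff using primrec_list_closed by blast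

lemma comp1_comp: "comp1 f \<Longrightarrow> comp1 a \<Longrightarrow> comp1 (\<lambda>x. f (a x))"
  unfolding comp1_def by (rule comput_comp1)

lemma comp1_primrec_fun2:
  assumes "primrec_fun2 f" "comp1 a" "comp1 b"
  shows "comp1 (\<lambda>x. f (a x) (b x))"
proof -
  obtain g where g: "primrec_list 2 g" "\<And>x y. f x y = g [x, y]"
    using assms(1) unfolding primrec_fun2_def by blast
  have "comput 2 g" using primrec_list_closed[OF g(1)] by (auto simp: comput_def)
  then show ?thesis
    using comput_comp[of "[\<lambda>xs. a (hd xs), \<lambda>xs. b (hd xs)]" g 1] assms(2,3)
    by (auto simp: comp1_def g(2) numeral_2_eq_2)
qed

named_theorems comp1_intros

lemma comp1_id [comp1_intros]: "comp1 (\<lambda>x. x)"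
  unfolding comp1_def by (rule comput_cong[OF comput_nth[of 0]]) (auto simp: length_Suc_conv)

lemma comp1_basic [comp1_intros]:
  shows "comp1 (\<lambda>x. c)"
    and "comp1 a \<Longrightarrow> comp1 (\<lambda>x. Suc (a x))"
    and "comp1 a \<Longrightarrow> comp1 b \<Longrightarrow> comp1 (\<lambda>x. a x - b x)"
    and "comp1 a \<Longrightarrow> comp1 b \<Longrightarrow> comp1 u \<Longrightarrow> comp1 v \<Longrightarrow> comp1 (\<lambda>x. if a x = b x then u x else v x)"
    and "comp1 a \<Longrightarrow> comp1 b \<Longrightarrow> comp1 (\<lambda>x. prod_encode (a x, b x))"
    and "comp1 a \<Longrightarrow> comp1 (\<lambda>x. fst (prod_decode (a x)))"
    and "comp1 a \<Longrightarrow> comp1 (\<lambda>x. snd (prod_decode (a x)))"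
  unfolding comp1_def prod_encode_def case_prod_conv
  by (intro comput_const comput_Suc comput_diff comput_if_eq comput_add comput_triangle comput_prod_decode; assumption)+

abbreviation p1 :: "nat \<Rightarrow> nat" where "p1 z \<equiv> fst (prod_decode z)"
abbreviation p2 :: "nat \<Rightarrow> nat" where "p2 z \<equiv> snd (prod_decode z)"

lemma comp1_app2:
  assumes "comp1 (\<lambda>z. f (p1 z) (p2 z))" "comp1 a" "comp1 b"
  shows "comp1 (\<lambda>x. f (a x) (b x))"
  using comp1_comp[OF assms(1) comp1_basic(5)[OF assms(2,3)]] by simp

lemma comp1_app3:
  assumes "comp1 (\<lambda>z. f (p1 z) (p1 (p2 z)) (p2 (p2 z)))" "comp1 a" "comp1 b" "comp1 c"
  shows "comp1 (\<lambda>x. f (a x) (b x) (c x))"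
  using comp1_comp[OF assms(1) comp1_basic(5)[OF assms(2) comp1_basic(5)[OF assms(3,4)]]] by simp

lemma comp1_rec [comp1_intros]:
  assumes "comp1 n" "comp1 a" "comp1 (\<lambda>z. g (p1 z) (p1 (p2 z)) (p2 (p2 z)))"
  shows "comp1 (\<lambda>x. rec_nat (a x) (\<lambda>k r. g x k r) (n x))"
proof -
  let ?b = "\<lambda>ys. (\<lambda>z. g (p1 z) (p1 (p2 z)) (p2 (p2 z))) (prod_encode (ys ! 2, prod_encode (ys ! 0, ys ! 1)))"
  have "comput 3 ?b"
    by (rule comput_comp1[OF assms(3)[unfolded comp1_def]])
       (unfold prod_encode_def case_prod_conv, intro comput_add comput_triangle comput_nth, auto)
  then have "comput 1 (\<lambda>xs. rec_nat (a (hd xs)) (\<lambda>k r. ?b (k # r # xs)) (n (hd xs)))"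
    using assms by (intro comput_rec) (auto simp: comp1_def eval_nat_numeral)
  then show ?thesis
    unfolding comp1_def by (rule comput_cong) (auto simp: length_Suc_conv)
qed

section \<open>Lists and course-of-values recursion\<close>

lemma length_list_decode: "length (list_decode n) \<le> n"
proof (induction n rule: list_decode.induct)
  case (2 n)
  obtain x y where xy: "prod_decode n = (x, y)" by (cases "prod_decode n")
  then have "y \<le> n" using le_prod_encode_2[of y x] by (metis prod_decode_inverse)
  then show ?case using "2"[OF xy[symmetric]] xy by simp
qed simp

lemma comp1_fold [comp1_intros]:
  assumes "comp1 l" "comp1 a" "comp1 (\<lambda>z. s (p1 z) (p1 (p2 z)) (p2 (p2 z)))"
  shows "comp1 (\<lambda>x. fold (s x) (list_decode (l x)) (a x))"
proof -
  define step where "step x st = (if p1 st = 0 then st else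
    prod_encode (p2 (p1 st - 1), s x (p1 (p1 st - 1)) (p2 st)))" for x st
  have iter: "p2 (rec_nat (prod_encode (list_encode xs, c)) (\<lambda>k st. step x st) m) = fold (s x) xs c"
    if "length xs \<le> m" for m xs c x
  proof -
    have "rec_nat y (\<lambda>k st. step x st) m = (step x ^^ m) y" for y by (induction m) auto
    moreover have "p2 ((step x ^^ m) (prod_encode (list_encode xs, c))) = fold (s x) xs c"
      using that
    proof (induction m arbitrary: xs c)
      case (Suc m)
      have nil: "step x (prod_encode (0, c)) = prod_encode (0, c)" by (simp add: step_def)
      show ?case
      proof (cases xs)
        case Nil
        then show ?thesis using Suc.IH[of "[]" c] by (simp add: funpow_Suc_right nil del: funpow.simps)
      next
        case (Cons y ys)
        then have "step x (prod_encode (list_encode xs, c)) = prod_encode (list_encode ys, s x y c)"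
          by (simp add: step_def)
        then show ?thesis using Suc Cons by (simp add: funpow_Suc_right del: funpow.simps)
      qed
    qed simp
    ultimately show ?thesis by simp
  qed
  have "comp1 (\<lambda>x. p2 (rec_nat (prod_encode (l x, a x)) (\<lambda>k st. step x st) (l x)))"
    unfolding step_def by (intro comp1_intros comp1_app3[OF assms(3)] assms(1,2))
  then show ?thesis
    using iter[OF length_list_decode] by simp
qed

lemma fold_cons_code: "fold (\<lambda>y r. Suc (prod_encode (y, r))) xs (list_encode ys) = list_encode (rev xs @ ys)"
proof (induction xs arbitrary: ys)
  case (Cons x xs)
  then show ?case using Cons[of "x # ys"] by simp
qed simp

lemma comp1_rev: "comp1 l \<Longrightarrow> comp1 (\<lambda>x. list_encode (rev (list_decode (l x))))"
  using fold_cons_code[of _ "[]"]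
  by (simp flip: fold_cons_code[of _ "[]", simplified]) (intro comp1_intros)

lemma comp1_foldr [comp1_intros]:
  assumes "comp1 l" "comp1 a" "comp1 (\<lambda>z. s (p1 z) (p1 (p2 z)) (p2 (p2 z)))"
  shows "comp1 (\<lambda>x. foldr (s x) (list_decode (l x)) (a x))"
  using comp1_fold[OF comp1_rev[OF assms(1)] assms(2,3)] by (simp add: foldr_conv_fold)

lemma comp1_map [comp1_intros]:
  assumes "comp1 l" "comp1 (\<lambda>z. f (p1 z) (p2 z))"
  shows "comp1 (\<lambda>x. list_encode (map (f x) (list_decode (l x))))"
proof -
  have "foldr (\<lambda>y r. Suc (prod_encode (f x y, r))) xs 0 = list_encode (map (f x) xs)" for x xs
    by (induction xs) auto
  moreover have "comp1 (\<lambda>x. foldr (\<lambda>y r. Suc (prod_encode (f x y, r))) (list_decode (l x)) 0)"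
    by (intro comp1_intros comp1_app2[OF assms(2)] assms(1))
  ultimately show ?thesis by simp
qed

lemma comp1_snoc [comp1_intros]:
  assumes "comp1 l" "comp1 a"
  shows "comp1 (\<lambda>x. list_encode (list_decode (l x) @ [a x]))"
proof -
  have "foldr (\<lambda>y r. Suc (prod_encode (y, r))) xs (Suc (prod_encode (b, 0))) = list_encode (xs @ [b])" for xs b
    by (induction xs) auto
  moreover have "comp1 (\<lambda>x. foldr (\<lambda>y r. Suc (prod_encode (y, r))) (list_decode (l x)) (Suc (prod_encode (a x, 0))))"
    by (intro comp1_intros assms)
  ultimately show ?thesis by simp
qed

definition nth_code :: "nat \<Rightarrow> nat \<Rightarrow> nat" where
  "nth_code l i = p1 (rec_nat l (\<lambda>_ r. p2 (r - 1)) i - 1)"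

lemma nth_code: "i < length xs \<Longrightarrow> nth_code (list_encode xs) i = xs ! i"
proof -
  have "p2 0 = 0" using le_prod_encode_2[of "p2 0" "p1 0"] by simp
  then have tl: "p2 (list_encode ys - 1) = list_encode (tl ys)" for ys by (cases ys) auto
  have "rec_nat (list_encode xs) (\<lambda>_ r. p2 (r - 1)) i = list_encode (drop i xs)"
    by (induction i) (simp_all add: tl drop_Suc tl_drop del: One_nat_def)
  then show "i < length xs \<Longrightarrow> nth_code (list_encode xs) i = xs ! i"
    by (simp add: nth_code_def flip: Cons_nth_drop_Suc)
qed

lemma comp1_nth_code [comp1_intros]: "comp1 l \<Longrightarrow> comp1 i \<Longrightarrow> comp1 (\<lambda>x. nth_code (l x) (i x))"
  unfolding nth_code_def by (intro comp1_intros)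

text \<open>\<open>values_below\<close> lists the values at the arguments \<open>n - 1, \<dots>, 0\<close>.\<close>

definition values_below :: "(nat \<Rightarrow> nat \<Rightarrow> nat) \<Rightarrow> nat \<Rightarrow> nat" where
  "values_below g n = rec_nat 0 (\<lambda>k r. Suc (prod_encode (g k r, r))) n"

definition course_of_values :: "(nat \<Rightarrow> nat \<Rightarrow> nat) \<Rightarrow> nat \<Rightarrow> nat" where
  "course_of_values g n = g n (values_below g n)"

lemma nth_values_below: "i < n \<Longrightarrow> nth_code (values_below g n) (n - Suc i) = course_of_values g i"
proof -
  have "values_below g n = list_encode (map (course_of_values g) (rev [0..<n]))"
    by (induction n) (auto simp: values_below_def course_of_values_def)
  then show "i < n \<Longrightarrow> nth_code (values_below g n) (n - Suc i) = course_of_values g i"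
    by (simp add: nth_code rev_nth)
qed

lemma comp1_course_of_values [comp1_intros]:
  assumes "comp1 n" "comp1 (\<lambda>z. g (p1 z) (p1 (p2 z)) (p2 (p2 z)))"
  shows "comp1 (\<lambda>x. course_of_values (g x) (n x))"
proof -
  have "comp1 (\<lambda>x. values_below (g x) (n x))"
    unfolding values_below_def by (intro comp1_intros assms)
  then show ?thesis unfolding course_of_values_def by (intro comp1_app3[OF assms(2)] comp1_id assms(1))
qed

end

section \<open>Computing the greedy subfield\<close>

locale greedy_computation = primrec_closed P for P +
  fixes \<kappa> :: "'k :: field \<Rightarrow> nat" and \<nu> :: "'k alg_closure \<Rightarrow> nat" and M :: "'k alg_closure set"
    and incl neg min range_ind dec :: "nat \<Rightarrow> nat" and add mul fac :: "nat \<Rightarrow> nat \<Rightarrow> nat"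
  assumes M: "is_subfield M" "range to_ac \<subseteq> M" and inj: "inj \<nu>"
    and comp1_unary: "comp1 incl" "comp1 neg" "comp1 min" "comp1 range_ind" "comp1 dec"
    and comp1_binary: "comp1 (\<lambda>z. add (p1 z) (p2 z))" "comp1 (\<lambda>z. mul (p1 z) (p2 z))"
      "comp1 (\<lambda>z. fac (p1 z) (p2 z))"
    and incl: "\<nu> (to_ac c) = incl (\<kappa> c)"
    and neg: "\<nu> (- x) = neg (\<nu> x)"
    and add: "\<nu> (x + y) = add (\<nu> x) (\<nu> y)"
    and mul: "\<nu> (x * y) = mul (\<nu> x) (\<nu> y)"
    and min: "\<exists>p. p \<noteq> 0 \<and> poly (map_poly to_ac p) x = 0 \<and> min (\<nu> x) = poly_code \<kappa> p"
    and range_ind: "range_ind n = of_bool (n \<in> range \<nu>)"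
    and dec: "dec (sentence_code \<kappa> S) = of_bool (S \<in> Ex_theory M)"
    and fac: "root_tower \<rho> fs \<Longrightarrow> coeffs_vars_below (length fs) g \<Longrightarrow> spec_poly \<rho> g \<noteq> 0 \<Longrightarrow>
      \<exists>hs. fac (rterm_lists_code \<kappa> fs) (list_encode (map (rterm_code \<kappa>) g)) = rterm_lists_code \<kappa> hs \<and>
        spec_poly \<rho> g = smult (lead_coeff (spec_poly \<rho> g)) (prod_list (map (spec_poly \<rho>) hs)) \<and>
        (\<forall>h\<in>set hs. coeffs_vars_below (length fs) h \<and> lead_coeff (spec_poly \<rho> h) = 1 \<and>
          irreducible_over (adjoin (\<rho> ` {..<length fs})) (spec_poly \<rho> h))"
begin

definition eval_code :: "nat \<Rightarrow> nat \<Rightarrow> nat" where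
  "eval_code env = course_of_values (\<lambda>c vs.
     if p1 c = 0 then incl (p2 c)
     else if p1 c = 1 then nth_code env (p2 c)
     else if p1 c = 2 then neg (nth_code vs (c - Suc (p2 c)))
     else if p1 c = 3 then
       add (nth_code vs (c - Suc (p1 (p2 c)))) (nth_code vs (c - Suc (p2 (p2 c))))
     else mul (nth_code vs (c - Suc (p1 (p2 c)))) (nth_code vs (c - Suc (p2 (p2 c)))))"

lemma comp1_eval_code:
  assumes "comp1 e" "comp1 c"
  shows "comp1 (\<lambda>x. eval_code (e x) (c x))"
  unfolding eval_code_def
  by (intro comp1_intros comp1_unary[THEN comp1_comp] comp1_binary[THEN comp1_app2] assms[THEN comp1_comp])

lemma less_prod_encode: "0 < a \<Longrightarrow> b < prod_encode (a, b)"
proof -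
  have "n \<le> triangle n" for n by (induction n) auto
  from this[of "a + b"] show "0 < a \<Longrightarrow> b < prod_encode (a, b)" by (simp add: prod_encode_def)
qed

lemma eval_code:
  assumes "rterm_vars t \<subseteq> {..<n}"
  shows "eval_code (list_encode (map (\<lambda>i. \<nu> (\<rho> i)) [0..<n])) (rterm_code \<kappa> t) = \<nu> (eval_rterm \<rho> t)"
proof -
  let ?e = "list_encode (map (\<lambda>i. \<nu> (\<rho> i)) [0..<n])"
  have less: "rterm_code \<kappa> s < prod_encode (Suc a, prod_encode (rterm_code \<kappa> s, c))"
     "c < prod_encode (Suc a, prod_encode (rterm_code \<kappa> s, c))" for a c and s :: "'k rterm"
    using less_prod_encode[of "Suc a"] le_prod_encode_1 le_prod_encode_2 by (meson le_less_trans zero_less_Suc)+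
  show ?thesis using assms
  proof (induction t)
    case (Const a)
    then show ?case by (simp add: eval_code_def course_of_values_def incl)
  next
    case (Var i)
    then show ?case by (simp add: eval_code_def course_of_values_def nth_code)
  next
    case (Neg t)
    have "eval_code ?e (rterm_code \<kappa> (Neg t)) = neg (eval_code ?e (rterm_code \<kappa> t))"
      unfolding eval_code_def
      by (subst course_of_values_def) (simp add: nth_values_below less_prod_encode)
    then show ?case using Neg by (simp add: neg)
  next
    case (Add s t)
    have "eval_code ?e (rterm_code \<kappa> (Add s t)) = add (eval_code ?e (rterm_code \<kappa> s)) (eval_code ?e (rterm_code \<kappa> t))"
      unfolding eval_code_def
      by (subst course_of_values_def) (simp add: nth_values_below less[where a = 2, simplified])
    then show ?case using Add by (simp add: add)
  next
    case (Mul s t)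
    have "eval_code ?e (rterm_code \<kappa> (Mul s t)) = mul (eval_code ?e (rterm_code \<kappa> s)) (eval_code ?e (rterm_code \<kappa> t))"
      unfolding eval_code_def
      by (subst course_of_values_def) (simp add: nth_values_below less[where a = 3, simplified])
    then show ?case using Mul by (simp add: mul)
  qed
qed

definition terms_code :: "'k rterm list \<Rightarrow> nat" where
  "terms_code f = list_encode (map (rterm_code \<kappa>) f)"

definition value_code :: "nat \<Rightarrow> nat \<Rightarrow> nat \<Rightarrow> nat" where
  "value_code env h x = foldr (\<lambda>t r. add (eval_code env t) (mul x r)) (list_decode h) (\<nu> 0)"

definition horner_code :: "nat \<Rightarrow> nat \<Rightarrow> nat" where
  "horner_code i h = foldr (\<lambda>t r. prod_encode (3, prod_encode (t, prod_encode (4, prod_encode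
     (prod_encode (1, i), r))))) (list_decode h) (prod_encode (0, \<kappa> 0))"

lemma comp1_value_code:
  assumes "comp1 e" "comp1 h" "comp1 a"
  shows "comp1 (\<lambda>x. value_code (e x) (h x) (a x))"
  unfolding value_code_def
  by (intro comp1_intros comp1_binary[THEN comp1_app2] comp1_eval_code assms[THEN comp1_comp])

lemma comp1_horner_code:
  assumes "comp1 i" "comp1 h"
  shows "comp1 (\<lambda>x. horner_code (i x) (h x))"
  unfolding horner_code_def by (intro comp1_intros assms[THEN comp1_comp])

lemma value_code:
  assumes "coeffs_vars_below n h"
  shows "value_code (list_encode (map (\<lambda>i. \<nu> (\<rho> i)) [0..<n])) (terms_code h) (\<nu> x) = \<nu> (poly (spec_poly \<rho> h) x)"
  using assms unfolding value_code_def terms_code_def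
  by (induction h) (auto simp: coeffs_vars_below_def spec_poly_def eval_code add mul)

lemma horner_code: "horner_code i (terms_code h) = rterm_code \<kappa> (horner i h)"
  unfolding horner_code_def terms_code_def horner_def by (induction h) auto

text \<open>
  A state \<open>(F, (E, C))\<close> consists of the codes of a root tower, of its generators, and of the
  equations that define it. Rejected elements are replaced by the generator \<open>0\<close>, so that the
  \<open>n\<close>-th generator always belongs to the code \<open>n\<close>.
\<close>

definition chosen_factor :: "nat \<Rightarrow> nat \<Rightarrow> nat" where
  "chosen_factor n st = fold (\<lambda>h r. if value_code (p1 (p2 st)) h n = \<nu> 0 then h else r)
     (list_decode (fac (p1 st) (list_encode (map (\<lambda>c. prod_encode (0, c)) (list_decode (min n)))))) 0"

definition extend_state :: "nat \<Rightarrow> nat \<Rightarrow> nat \<Rightarrow> nat \<Rightarrow> nat" where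
  "extend_state n st h e = prod_encode (list_encode (list_decode (p1 st) @ [h]),
     prod_encode (list_encode (list_decode (p1 (p2 st)) @ [e]),
       Suc (prod_encode (horner_code n h, p2 (p2 st)))))"

definition answer :: "nat \<Rightarrow> nat \<Rightarrow> nat" where
  "answer n st = (if range_ind n = 1
     then dec (Suc (prod_encode (Suc (prod_encode (horner_code n (chosen_factor n st), p2 (p2 st))), 0)))
     else 0)"

definition next_state :: "nat \<Rightarrow> nat \<Rightarrow> nat" where
  "next_state n st = (if answer n st = 1 then extend_state n st (chosen_factor n st) n
     else extend_state n st (terms_code [Const 0, Const 1]) (\<nu> 0))"

definition state :: "nat \<Rightarrow> nat" where
  "state n = rec_nat (prod_encode (0, prod_encode (0, 0))) next_state n"

lemma comp1_chosen_factor: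
  assumes "comp1 n" "comp1 st"
  shows "comp1 (\<lambda>x. chosen_factor (n x) (st x))"
  unfolding chosen_factor_def
  by (intro comp1_intros comp1_value_code comp1_binary(3)[THEN comp1_app2] comp1_unary(3)[THEN comp1_comp]
    assms[THEN comp1_comp])

lemma comp1_extend_state: "comp1 n \<Longrightarrow> comp1 st \<Longrightarrow> comp1 h \<Longrightarrow> comp1 e \<Longrightarrow> comp1 (\<lambda>x. extend_state (n x) (st x) (h x) (e x))"
  unfolding extend_state_def by (intro comp1_intros comp1_horner_code)

lemma comp1_answer: "comp1 n \<Longrightarrow> comp1 st \<Longrightarrow> comp1 (\<lambda>x. answer (n x) (st x))"
  unfolding answer_def
  by (intro comp1_intros comp1_horner_code comp1_chosen_factor comp1_unary(4,5)[THEN comp1_comp])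

lemma comp1_state: "comp1 state"
  unfolding state_def next_state_def
  by (intro comp1_intros comp1_extend_state comp1_chosen_factor comp1_answer)

definition elt :: "nat \<Rightarrow> 'k alg_closure" where
  "elt n = (if n \<in> \<nu> ` greedy \<nu> M then inv_into UNIV \<nu> n else 0)"

lemma elt_code: "elt (\<nu> x) = (if x \<in> greedy \<nu> M then x else 0)"
  using inj by (auto simp: elt_def dest: injD)

lemma elt_notin: "n \<notin> range \<nu> \<Longrightarrow> elt n = 0"
  by (auto simp: elt_def)

definition state_inv :: "nat \<Rightarrow> 'k rterm list list \<Rightarrow> nat \<Rightarrow> bool" where
  "state_inv n fs st \<longleftrightarrow> length fs = n \<and> root_tower elt fs \<and>
     (\<exists>C. set C = (\<lambda>i. horner i (fs ! i)) ` {..<n} \<and>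
       st = prod_encode (rterm_lists_code \<kappa> fs,
         prod_encode (list_encode (map (\<lambda>i. \<nu> (elt i)) [0..<n]), terms_code C)))"

lemma chosen_factor:
  assumes st: "state_inv n fs st" and x: "\<nu> x = n"
  shows "\<exists>h. chosen_factor n st = terms_code h \<and> root_tower (elt(n := x)) (fs @ [h])"
proof -
  have n: "length fs = n" and tower: "root_tower elt fs" and p1st: "p1 st = rterm_lists_code \<kappa> fs"
    and env: "p1 (p2 st) = list_encode (map (\<lambda>i. \<nu> (elt i)) [0..<n])"
    using st by (auto simp: state_inv_def)
  obtain p where p: "p \<noteq> 0" "poly (map_poly to_ac p) x = 0" "min n = poly_code \<kappa> p"
    using min x by blast
  define g where "g = map Const (coeffs p)"
  have g: "spec_poly elt g = map_poly to_ac p"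
    by (simp add: g_def spec_poly_def map_poly_def o_def)
  have gc: "list_encode (map (\<lambda>c. prod_encode (0, c)) (list_decode (min n))) = list_encode (map (rterm_code \<kappa>) g)"
    by (simp add: p(3) poly_code_def g_def o_def)
  have "coeffs_vars_below (length fs) g" by (auto simp: coeffs_vars_below_def g_def)
  moreover have g0: "spec_poly elt g \<noteq> 0" using p(1) by (simp add: g map_poly_eq_0_iff)
  ultimately obtain hs where hs:
    "fac (rterm_lists_code \<kappa> fs) (list_encode (map (rterm_code \<kappa>) g)) = rterm_lists_code \<kappa> hs"
    "spec_poly elt g = smult (lead_coeff (spec_poly elt g)) (prod_list (map (spec_poly elt) hs))"
    "\<forall>h\<in>set hs. coeffs_vars_below (length fs) h \<and> lead_coeff (spec_poly elt h) = 1 \<and>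
       irreducible_over (adjoin (elt ` {..<length fs})) (spec_poly elt h)"
    using fac[OF tower] by blast
  have "poly (prod_list (map (spec_poly elt) hs)) x = 0"
    using arg_cong[OF hs(2), of "\<lambda>q. poly q x"] g0 p(2) by (simp add: g)
  then have ex: "\<exists>h\<in>set hs. poly (spec_poly elt h) x = 0"
    by (induction hs) auto
  have root: "value_code (p1 (p2 st)) (terms_code h) n = \<nu> 0 \<longleftrightarrow> poly (spec_poly elt h) x = 0"
    if "h \<in> set hs" for h
  proof -
    have "coeffs_vars_below n h" using hs(3) that n by simp
    then have "value_code (p1 (p2 st)) (terms_code h) n = \<nu> (poly (spec_poly elt h) x)"
      unfolding env x[symmetric] using value_code by simp
    then show ?thesis using inj by (auto dest: injD)
  qed
  have fold: "(\<exists>y\<in>set ys. Q y) \<Longrightarrow> \<exists>y\<in>set ys. Q y \<and> fold (\<lambda>h r. if Q h then h else r) ys z = y"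
    for ys Q and z :: nat
    by (induction ys rule: rev_induct) auto
  have "list_decode (rterm_lists_code \<kappa> hs) = map terms_code hs"
    by (simp add: rterm_lists_code_def terms_code_def[abs_def])
  then have "chosen_factor n st = fold (\<lambda>h r. if value_code (p1 (p2 st)) h n = \<nu> 0 then h else r) (map terms_code hs) 0"
    by (simp only: chosen_factor_def gc p1st hs(1))
  then obtain h where h: "h \<in> set hs" "chosen_factor n st = terms_code h" "poly (spec_poly elt h) x = 0"
    using fold[of "map terms_code hs" "\<lambda>h. value_code (p1 (p2 st)) h n = \<nu> 0" 0] ex root by auto
  have eq: "spec_poly (elt(n := x)) h = spec_poly elt h"
    by (rule spec_poly_cong[of n]) (use hs(3) h(1) n in auto)
  have im: "(elt(n := x)) ` {..<n} = elt ` {..<n}" by auto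
  have "root_tower (elt(n := x)) fs" by (rule root_tower_cong[OF tower]) (use n in auto)
  then have "root_tower (elt(n := x)) (fs @ [h])"
    unfolding root_tower_snoc n eq im using hs(3) h n by simp
  then show ?thesis using h(2) by blast
qed

lemma embeds_elt_iff: "embeds M (insert x (elt ` {..<n})) \<longleftrightarrow> embeds M (insert x (stage \<nu> M n))"
proof -
  have 1: "insert x (stage \<nu> M n) \<subseteq> insert x (elt ` {..<n})"
  proof
    fix y assume "y \<in> insert x (stage \<nu> M n)"
    then have "y = x \<or> \<nu> y < n \<and> elt (\<nu> y) = y" by (auto simp: mem_stage_iff elt_code)
    then show "y \<in> insert x (elt ` {..<n})" by (metis imageI insertCI lessThan_iff)
  qed
  have "elt i \<in> insert 0 (stage \<nu> M n)" if "i < n" for i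
    using that by (cases "i \<in> range \<nu>") (auto simp: elt_code elt_notin mem_stage_iff)
  then have "insert x (elt ` {..<n}) \<subseteq> insert 0 (insert x (stage \<nu> M n))" by auto
  then have 2: "insert x (elt ` {..<n}) \<subseteq> adjoin (insert x (stage \<nu> M n))"
    using adjoin_superset(1)[of "insert 0 (insert x (stage \<nu> M n))"] by (auto simp: adjoin_insert_0)
  show ?thesis
    using embeds_subset_adjoin[OF M _ 2] embeds_subset_adjoin[OF M _ order_trans[OF 1 adjoin_superset(1)]]
    by blast
qed

lemma conjunction_snoc:
  assumes "set C = (\<lambda>i. horner i (fs ! i)) ` {..<n}" "length fs = n"
  shows "set (horner n h # C) = (\<lambda>i. horner i ((fs @ [h]) ! i)) ` {..<Suc n}"
proof -
  have "(\<lambda>i. horner i ((fs @ [h]) ! i)) ` {..<n} = (\<lambda>i. horner i (fs ! i)) ` {..<n}"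
    using assms(2) by (auto simp: nth_append)
  then show ?thesis using assms nth_append_length[of fs h "[]"] by (simp add: lessThan_Suc)
qed

lemma answer:
  assumes "state_inv n fs st"
  shows "answer n st = of_bool (n \<in> \<nu> ` greedy \<nu> M)"
proof (cases "n \<in> range \<nu>")
  case True
  then obtain x where x: "\<nu> x = n" by blast
  obtain C where C: "set C = (\<lambda>i. horner i (fs ! i)) ` {..<n}" "p2 (p2 st) = terms_code C"
    and n: "length fs = n"
    using assms by (auto simp: state_inv_def)
  obtain h where h: "chosen_factor n st = terms_code h" "root_tower (elt(n := x)) (fs @ [h])"
    using chosen_factor[OF assms x] by blast
  have "answer n st = dec (sentence_code \<kappa> [horner n h # C])"
    using True
    by (simp add: answer_def range_ind h(1) C(2) horner_code sentence_code_def)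
       (simp add: terms_code_def)
  also have "\<dots> = of_bool (holds_in M [horner n h # C])"
    by (simp add: dec Ex_theory_def)
  also have "holds_in M [horner n h # C] \<longleftrightarrow> embeds M ((elt(n := x)) ` {..<Suc n})"
    using holds_in_root_tower_iff[OF M(1) h(2), of "horner n h # C"] conjunction_snoc[OF C(1) n] n
    by simp
  also have "(elt(n := x)) ` {..<Suc n} = insert x (elt ` {..<n})" by (auto simp: lessThan_Suc)
  also have "embeds M (insert x (elt ` {..<n})) \<longleftrightarrow> x \<in> greedy \<nu> M"
    by (simp add: embeds_elt_iff greedy_def x)
  also have "x \<in> greedy \<nu> M \<longleftrightarrow> n \<in> \<nu> ` greedy \<nu> M"
    using inj x by (auto dest: injD)
  finally show ?thesis .
qed (auto simp: answer_def range_ind)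

lemma state_inv_extend_state:
  assumes "state_inv n fs st" "root_tower elt (fs @ [h])"
  shows "state_inv (Suc n) (fs @ [h]) (extend_state n st (terms_code h) (\<nu> (elt n)))"
proof -
  obtain C where C: "set C = (\<lambda>i. horner i (fs ! i)) ` {..<n}"
    and st: "st = prod_encode (rterm_lists_code \<kappa> fs,
         prod_encode (list_encode (map (\<lambda>i. \<nu> (elt i)) [0..<n]), terms_code C))"
    and n: "length fs = n"
    using assms by (auto simp: state_inv_def)
  have "extend_state n st (terms_code h) (\<nu> (elt n)) = prod_encode (rterm_lists_code \<kappa> (fs @ [h]),
         prod_encode (list_encode (map (\<lambda>i. \<nu> (elt i)) [0..<Suc n]), terms_code (horner n h # C)))"
    by (simp add: extend_state_def st rterm_lists_code_def horner_code) (simp add: terms_code_def)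
  then show ?thesis
    unfolding state_inv_def using conjunction_snoc[OF C n, of h] assms(2) n
    by (intro conjI exI[of _ "horner n h # C"]) auto
qed

lemma state_inv_state: "\<exists>fs. state_inv n fs (state n)"
proof (induction n)
  case 0
  show ?case
    by (intro exI[of _ "[]"]) (auto simp: state_inv_def root_tower_def state_def rterm_lists_code_def terms_code_def)
next
  case (Suc n)
  then obtain fs where st: "state_inv n fs (state n)" by blast
  have Suc_n: "state (Suc n) = next_state n (state n)" by (simp add: state_def)
  show ?case
  proof (cases "n \<in> \<nu> ` greedy \<nu> M")
    case True
    then obtain x where x: "\<nu> x = n" "x \<in> greedy \<nu> M" by blast
    then have elt: "elt n = x" using elt_code by force
    obtain h where h: "chosen_factor n (state n) = terms_code h" "root_tower (elt(n := x)) (fs @ [h])"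
      using chosen_factor[OF st x(1)] by blast
    have "elt(n := x) = elt" using elt by auto
    then have "state_inv (Suc n) (fs @ [h]) (extend_state n (state n) (terms_code h) (\<nu> (elt n)))"
      using state_inv_extend_state[OF st] h(2) by simp
    then show ?thesis
      using True by (auto simp: Suc_n next_state_def answer[OF st] h(1) elt x(1))
  next
    case False
    then have elt: "elt n = 0" by (simp add: elt_def)
    let ?h = "[Const 0, Const 1] :: 'k rterm list"
    have poly: "spec_poly elt ?h = [:0, 1:]" by (simp add: spec_poly_def)
    have "irreducible_over F [:0, 1:]" if "is_subfield F" for F :: "'k alg_closure set"
    proof -
      have "degree q = 0 \<or> degree r = 0" if "[:0, 1:] = q * r" for q r :: "'k alg_closure poly"
      proof -
        have "q \<noteq> 0" "r \<noteq> 0" using that by auto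
        then have "degree q + degree r = degree [:0, 1 :: 'k alg_closure:]"
          unfolding that by (simp add: degree_mult_eq)
        then show ?thesis by auto
      qed
      then show ?thesis using that
        by (simp add: irreducible_over_def poly_over_pCons[OF that] poly_over_0[OF that] is_subfield_def)
    qed
    from this[OF is_subfield_adjoin] have "root_tower elt (fs @ [?h])"
      unfolding root_tower_snoc poly using st elt by (simp add: state_inv_def coeffs_vars_below_def)
    from state_inv_extend_state[OF st this] show ?thesis
      using False by (auto simp: Suc_n next_state_def answer[OF st] elt)
  qed
qed

theorem comp1_greedy: "comp1 (\<lambda>n. of_bool (n \<in> \<nu> ` greedy \<nu> M))"
proof -
  have "answer n (state n) = of_bool (n \<in> \<nu> ` greedy \<nu> M)" for n
    using state_inv_state answer by blast
  moreover have "comp1 (\<lambda>n. answer n (state n))"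
    by (intro comp1_answer comp1_id comp1_state)
  ultimately show ?thesis by simp
qed

end

lemma (in primrec_closed) comp1_greedy_subfield:
  fixes \<kappa> :: "'k :: field \<Rightarrow> nat" and \<nu> :: "'k alg_closure \<Rightarrow> nat"
  assumes "presented_with_elimination_theory \<kappa>" and "presents_alg_closure \<kappa> \<nu>"
    and M: "is_subfield M" "range to_ac \<subseteq> M"
    and dec: "comp1 dec" "\<And>S. dec (sentence_code \<kappa> S) = of_bool (S \<in> Ex_theory M)"
  shows "comp1 (\<lambda>n. of_bool (n \<in> \<nu> ` greedy \<nu> M))"
proof -
  have "presented_field \<nu>" and "has_effective_root_adjunction \<kappa>"
    using assms(1,2) by (auto simp: presents_alg_closure_def presented_with_elimination_theory_def)
  obtain add mul neg where \<nu>: "inj \<nu>" "primrec_set (range \<nu>)"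
    "primrec_fun2 add" "\<And>x y. \<nu> (x + y) = add (\<nu> x) (\<nu> y)"
    "primrec_fun2 mul" "\<And>x y. \<nu> (x * y) = mul (\<nu> x) (\<nu> y)"
    "primrec_fun neg" "\<And>x. \<nu> (- x) = neg (\<nu> x)"
    using \<open>presented_field \<nu>\<close> unfolding presented_field_def by metis
  obtain incl min where emb: "primrec_fun incl" "\<And>a. \<nu> (to_ac a) = incl (\<kappa> a)"
    "primrec_fun min" "\<And>x. \<exists>p. p \<noteq> 0 \<and> poly (map_poly to_ac p) x = 0 \<and> min (\<nu> x) = poly_code \<kappa> p"
    using assms(2) unfolding presents_alg_closure_def by metis
  obtain fac where fac: "primrec_fun2 fac"
    "\<forall>fs g \<rho>. root_tower \<rho> fs \<and> coeffs_vars_below (length fs) g \<and> spec_poly \<rho> g \<noteq> 0 \<longrightarrow>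
       (\<exists>hs. fac (rterm_lists_code \<kappa> fs) (list_encode (map (rterm_code \<kappa>) g)) = rterm_lists_code \<kappa> hs \<and>
         spec_poly \<rho> g = smult (lead_coeff (spec_poly \<rho> g)) (prod_list (map (spec_poly \<rho>) hs)) \<and>
         (\<forall>h\<in>set hs. coeffs_vars_below (length fs) h \<and> lead_coeff (spec_poly \<rho> h) = 1 \<and>
            irreducible_over (adjoin (\<rho> ` {..<length fs})) (spec_poly \<rho> h)))"
    using \<open>has_effective_root_adjunction \<kappa>\<close> unfolding has_effective_root_adjunction_def by blast
  have bin: "comp1 (\<lambda>z. f (p1 z) (p2 z))" if "primrec_fun2 f" for f
    using that by (rule comp1_primrec_fun2) (intro comp1_intros)+
  interpret greedy_computation P \<kappa> \<nu> M incl neg min "\<lambda>n. of_bool (n \<in> range \<nu>)" dec add mul fac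
    using M \<nu> emb dec fac(2)
    by unfold_locales
       (auto intro!: primrec_fun_comp1 bin fac(1) simp: primrec_set_def)
  show ?thesis by (rule comp1_greedy)
qed

lemma primrec_closed_primrec_list: "primrec_closed primrec_list"
  by unfold_locales (use primrec_list.intros in \<open>auto simp del: One_nat_def\<close>)

lemma primrec_closed_recursive_list: "primrec_closed recursive_list"
  by unfold_locales (use recursive_list.intros in \<open>auto simp del: One_nat_def\<close>)

theorem theorem2p7:
  fixes \<kappa> :: "'k :: field \<Rightarrow> nat"
    and \<nu> :: "'k alg_closure \<Rightarrow> nat"
    and M :: "'k alg_closure set"
  assumes "presented_with_elimination_theory \<kappa>"
    and "presents_alg_closure \<kappa> \<nu>"
    and "perfect_subfield M"
    and "range to_ac \<subseteq> M"
  shows "(decidable_Ex \<kappa> M \<longrightarrow>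
            (\<exists>L. recursive_subfield \<nu> L \<and> range to_ac \<subseteq> L \<and> K_isomorphic M L)) \<and>
         (primitively_decidable_Ex \<kappa> M \<longrightarrow>
            (\<exists>L. primrec_subfield \<nu> L \<and> range to_ac \<subseteq> L \<and> K_isomorphic M L))"
proof -
  have M: "is_subfield M" using assms(3) by (simp add: perfect_subfield_def)
  have inj: "inj \<nu>"
    using assms(2) by (simp add: presents_alg_closure_def presented_with_elimination_theory_def presented_field_def)
  note greedy = is_subfield_greedy[OF inj M assms(4)] range_to_ac_greedy[OF inj M assms(4)]
    K_isomorphic_greedy[OF inj M assms(4)]
  show ?thesis
  proof (intro conjI impI)
    interpret primrec_closed recursive_list by (rule primrec_closed_recursive_list)
    assume "decidable_Ex \<kappa> M"
    then have "recursive_set (\<nu> ` greedy \<nu> M)"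
      using comp1_greedy_subfield[OF assms(1,2) M assms(4)]
      unfolding decidable_Ex_def recursive_set_def recursive_fun_def comp1_iff by blast
    then show "\<exists>L. recursive_subfield \<nu> L \<and> range to_ac \<subseteq> L \<and> K_isomorphic M L"
      unfolding recursive_subfield_def using greedy by blast
  next
    interpret primrec_closed primrec_list by (rule primrec_closed_primrec_list)
    assume "primitively_decidable_Ex \<kappa> M"
    then have "primrec_set (\<nu> ` greedy \<nu> M)"
      using comp1_greedy_subfield[OF assms(1,2) M assms(4)]
      unfolding primitively_decidable_Ex_def primrec_set_def primrec_fun_def comp1_iff by blast
    then show "\<exists>L. primrec_subfield \<nu> L \<and> range to_ac \<subseteq> L \<and> K_isomorphic M L"
      unfolding primrec_subfield_def using greedy by blast
  qed
qed

end
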